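(* Let $(A_0,\mathbf{C}^t)$ be the free tangled closure algebra on a set $\{p_n:n<\omega\}\cup\{q\}$ of distinct generators, with induced closure operator $\mathbf{C}$ and interior operator $\mathbf{I}$, and let $x_0$ be an ultrafilter of $A_0$ with $\mathbf{C}^t\{q,-q\}\notin x_0$ and $\{p_0\}\cup\{\mathbf{I}(p_{2n}\Rightarrow\mathbf{C}(p_{2n+1}\land q)),\ \mathbf{I}(p_{2n+1}\Rightarrow\mathbf{C}(p_{2n+2}\land -q)):n<\omega\}\subseteq x_0$ (such an $x_0$ exists). Let $U_0$ be the set of ultrafilters of $A_0$, let $R$ be the relation on $U_0$ with $xRy$ iff $\{a\in A_0:\mathbf{I}a\in x\}\subseteq y$, let $U=\{y\in U_0: x_0Ry\}$, put $[a]=\{x\in U: a\in x\}$ for $a\in A_0$, and let $A=\{[a]:a\in A_0\}$, a Boolean algebra of subsets of $U$. Define $\mathbf{C}^t_A\{[\gamma]:\gamma\in\varGamma\}=[\mathbf{C}^t\varGamma]$ for finite non-empty $\varGamma\subseteq A_0$ (this is well defined and $(A,\mathbf{C}^t_A)$ is a tangled closure algebra). Then for every tangled closure algebra $(B,\mathbf{C}^t_B)$ in which $B$ is a complete Boolean algebra, there is no injective Boolean homomorphism $f:A\to B$ satisfying $f(\mathbf{C}^t_A\Delta)=\mathbf{C}^t_B\{f\delta:\delta\in\Delta\}$ for all finite non-empty $\Delta\subseteq A$.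
   Context: A Boolean algebra $A$ has operations $\land,\lor,-,0,1$; $a\Rightarrow b=-a\lor b$. A closure operator on $A$ is $\mathbf{C}:A\to A$ with $\mathbf{C}(a\lor b)=\mathbf{C}a\lor\mathbf{C}b$, $\mathbf{C}0=0$, $a\leq\mathbf{C}a=\mathbf{C}\mathbf{C}a$; interior $\mathbf{I}a=-\mathbf{C}-a$. For $\mathbf{C}^t$ from finite non-empty subsets of $A$ to $A$, the induced $\mathbf{C}a=\mathbf{C}^t\{a\}$, $\mathbf{I}a=-\mathbf{C}^t\{-a\}$; $(A,\mathbf{C}^t)$ is a tangled closure algebra if $\mathbf{C}$ is a closure operator and for all finite non-empty $\varGamma\subseteq A$ and $a\in A$: (Fix) $\mathbf{C}^t\varGamma\leq\bigwedge_{\gamma\in\varGamma}\mathbf{C}(\gamma\land\mathbf{C}^t\varGamma)$; (Ind) $\mathbf{I}(a\Rightarrow\bigwedge_{\gamma\in\varGamma}\mathbf{C}(\gamma\land a))\land a\leq\mathbf{C}^t\varGamma$. A homomorphism of tangled closure algebras $(A,\mathbf{C}^t_A)\to(B,\mathbf{C}^t_B)$ is a Boolean homomorphism $f$ with $f(\mathbf{C}^t_A\varGamma)=\mathbf{C}^t_B\{f\gamma:\gamma\in\varGamma\}$ for all finite non-empty $\varGamma$. The free tangled closure algebra on a set $V$ is a tangled closure algebra containing $V$ and generated by it, such that every function from $V$ into any tangled closure algebra extends uniquely to a tangled closure algebra homomorphism (it exists, e.g. as the Lindenbaum–Tarski algebra of the corresponding modal logic). *)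

theory Defs
  imports "HOL-Algebra.Complete_Lattice" "HOL-Library.Countable_Set"
begin

section \<open>Boolean algebras\<close>

text \<open>
  Boolean algebras carry an explicit carrier set: the algebra of sets studied below depends on an
  ultrafilter, so it cannot be an instance of the type class of Boolean algebras.  The library class
  of complete Boolean algebras would moreover be too narrow for the target algebras, as it includes
  complete distributivity.  The one-element algebra is not excluded.
\<close>

record 'a bool_alg = "'a partial_object" +
  bmeet :: "'a \<Rightarrow> 'a \<Rightarrow> 'a" (infixl \<open>\<^bold>\<and>\<index>\<close> 70)
  bjoin :: "'a \<Rightarrow> 'a \<Rightarrow> 'a" (infixl \<open>\<^bold>\<or>\<index>\<close> 65)
  bcompl :: "'a \<Rightarrow> 'a" (\<open>\<^bold>-\<index> _\<close> [81] 80)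
  bzero :: 'a (\<open>\<^bold>0\<index>\<close>)
  bone :: 'a (\<open>\<^bold>1\<index>\<close>)

locale boolean_alg =
  fixes A (structure)
  assumes meet_closed: "\<lbrakk>a \<in> carrier A; b \<in> carrier A\<rbrakk> \<Longrightarrow> a \<^bold>\<and> b \<in> carrier A"
    and join_closed: "\<lbrakk>a \<in> carrier A; b \<in> carrier A\<rbrakk> \<Longrightarrow> a \<^bold>\<or> b \<in> carrier A"
    and compl_closed: "a \<in> carrier A \<Longrightarrow> \<^bold>- a \<in> carrier A"
    and zero_closed: "\<^bold>0 \<in> carrier A"
    and one_closed: "\<^bold>1 \<in> carrier A"
    and meet_assoc: "\<lbrakk>a \<in> carrier A; b \<in> carrier A; c \<in> carrier A\<rbrakk>
      \<Longrightarrow> (a \<^bold>\<and> b) \<^bold>\<and> c = a \<^bold>\<and> (b \<^bold>\<and> c)"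
    and join_assoc: "\<lbrakk>a \<in> carrier A; b \<in> carrier A; c \<in> carrier A\<rbrakk>
      \<Longrightarrow> (a \<^bold>\<or> b) \<^bold>\<or> c = a \<^bold>\<or> (b \<^bold>\<or> c)"
    and meet_comm: "\<lbrakk>a \<in> carrier A; b \<in> carrier A\<rbrakk> \<Longrightarrow> a \<^bold>\<and> b = b \<^bold>\<and> a"
    and join_comm: "\<lbrakk>a \<in> carrier A; b \<in> carrier A\<rbrakk> \<Longrightarrow> a \<^bold>\<or> b = b \<^bold>\<or> a"
    and meet_join_absorb: "\<lbrakk>a \<in> carrier A; b \<in> carrier A\<rbrakk> \<Longrightarrow> a \<^bold>\<and> (a \<^bold>\<or> b) = a"
    and join_meet_absorb: "\<lbrakk>a \<in> carrier A; b \<in> carrier A\<rbrakk> \<Longrightarrow> a \<^bold>\<or> (a \<^bold>\<and> b) = a"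
    and meet_join_distrib: "\<lbrakk>a \<in> carrier A; b \<in> carrier A; c \<in> carrier A\<rbrakk>
      \<Longrightarrow> a \<^bold>\<and> (b \<^bold>\<or> c) = (a \<^bold>\<and> b) \<^bold>\<or> (a \<^bold>\<and> c)"
    and join_meet_distrib: "\<lbrakk>a \<in> carrier A; b \<in> carrier A; c \<in> carrier A\<rbrakk>
      \<Longrightarrow> a \<^bold>\<or> (b \<^bold>\<and> c) = (a \<^bold>\<or> b) \<^bold>\<and> (a \<^bold>\<or> c)"
    and meet_one: "a \<in> carrier A \<Longrightarrow> a \<^bold>\<and> \<^bold>1 = a"
    and join_zero: "a \<in> carrier A \<Longrightarrow> a \<^bold>\<or> \<^bold>0 = a"
    and meet_compl: "a \<in> carrier A \<Longrightarrow> a \<^bold>\<and> \<^bold>- a = \<^bold>0"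
    and join_compl: "a \<in> carrier A \<Longrightarrow> a \<^bold>\<or> \<^bold>- a = \<^bold>1"

definition ba_order :: "('a, 'm) bool_alg_scheme \<Rightarrow> 'a gorder" where
  "ba_order A = \<lparr>carrier = carrier A, eq = (=), le = (\<lambda>a b. a \<^bold>\<and>\<^bsub>A\<^esub> b = a)\<rparr>"

abbreviation ba_le :: "('a, 'm) bool_alg_scheme \<Rightarrow> 'a \<Rightarrow> 'a \<Rightarrow> bool"
    (\<open>(_ \<^bold>\<le>\<index> _)\<close> [51, 51] 50) where
  "a \<^bold>\<le>\<^bsub>A\<^esub> b \<equiv> a \<sqsubseteq>\<^bsub>ba_order A\<^esub> b"

abbreviation ba_Meet :: "('a, 'm) bool_alg_scheme \<Rightarrow> 'a set \<Rightarrow> 'a" (\<open>\<^bold>\<And>\<index> _\<close> [90] 90) where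
  "\<^bold>\<And>\<^bsub>A\<^esub> S \<equiv> \<Sqinter>\<^bsub>ba_order A\<^esub> S"

abbreviation bimp :: "('a, 'm) bool_alg_scheme \<Rightarrow> 'a \<Rightarrow> 'a \<Rightarrow> 'a"
    (\<open>(_ \<^bold>\<Rightarrow>\<index> _)\<close> [61, 60] 60) where
  "a \<^bold>\<Rightarrow>\<^bsub>A\<^esub> b \<equiv> \<^bold>-\<^bsub>A\<^esub> a \<^bold>\<or>\<^bsub>A\<^esub> b"

definition ba_hom ::
    "('a, 'm) bool_alg_scheme \<Rightarrow> ('b, 'n) bool_alg_scheme \<Rightarrow> ('a \<Rightarrow> 'b) \<Rightarrow> bool" where
  "ba_hom A B f \<longleftrightarrow>
     f \<in> carrier A \<rightarrow> carrier B \<and>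
     (\<forall>a\<in>carrier A. \<forall>b\<in>carrier A. f (a \<^bold>\<and>\<^bsub>A\<^esub> b) = f a \<^bold>\<and>\<^bsub>B\<^esub> f b) \<and>
     (\<forall>a\<in>carrier A. \<forall>b\<in>carrier A. f (a \<^bold>\<or>\<^bsub>A\<^esub> b) = f a \<^bold>\<or>\<^bsub>B\<^esub> f b) \<and>
     (\<forall>a\<in>carrier A. f (\<^bold>-\<^bsub>A\<^esub> a) = \<^bold>-\<^bsub>B\<^esub> f a) \<and>
     f \<^bold>0\<^bsub>A\<^esub> = \<^bold>0\<^bsub>B\<^esub> \<and> f \<^bold>1\<^bsub>A\<^esub> = \<^bold>1\<^bsub>B\<^esub>"

definition ultrafilter :: "('a, 'm) bool_alg_scheme \<Rightarrow> 'a set \<Rightarrow> bool" where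
  "ultrafilter A x \<longleftrightarrow>
     x \<subseteq> carrier A \<and> \<^bold>1\<^bsub>A\<^esub> \<in> x \<and> \<^bold>0\<^bsub>A\<^esub> \<notin> x \<and>
     (\<forall>a\<in>x. \<forall>b\<in>carrier A. a \<^bold>\<le>\<^bsub>A\<^esub> b \<longrightarrow> b \<in> x) \<and>
     (\<forall>a\<in>x. \<forall>b\<in>x. a \<^bold>\<and>\<^bsub>A\<^esub> b \<in> x) \<and>
     (\<forall>a\<in>carrier A. a \<in> x \<or> \<^bold>-\<^bsub>A\<^esub> a \<in> x)"


section \<open>Tangled closure algebras\<close>

text \<open>Only the values of the tangle operation on finite non-empty subsets of the carrier matter.\<close>

record 'a tangle_alg = "'a bool_alg" +
  tangle :: "'a set \<Rightarrow> 'a" (\<open>\<^bold>C\<^sup>t\<index> _\<close> [90] 90)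

definition cl :: "('a, 'm) tangle_alg_scheme \<Rightarrow> 'a \<Rightarrow> 'a" (\<open>\<^bold>C\<index> _\<close> [90] 90) where
  "\<^bold>C\<^bsub>A\<^esub> a = \<^bold>C\<^sup>t\<^bsub>A\<^esub> {a}"

definition itr :: "('a, 'm) tangle_alg_scheme \<Rightarrow> 'a \<Rightarrow> 'a" (\<open>\<^bold>I\<index> _\<close> [90] 90) where
  "\<^bold>I\<^bsub>A\<^esub> a = \<^bold>-\<^bsub>A\<^esub> \<^bold>C\<^sup>t\<^bsub>A\<^esub> {\<^bold>-\<^bsub>A\<^esub> a}"

definition fin_subset :: "('a, 'm) partial_object_scheme \<Rightarrow> 'a set \<Rightarrow> bool" where
  "fin_subset A \<Gamma> \<longleftrightarrow> finite \<Gamma> \<and> \<Gamma> \<noteq> {} \<and> \<Gamma> \<subseteq> carrier A"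

locale tangled_closure_algebra = boolean_alg A for A (structure) +
  assumes tangle_closed: "fin_subset A \<Gamma> \<Longrightarrow> \<^bold>C\<^sup>t \<Gamma> \<in> carrier A"
    and cl_join: "\<lbrakk>a \<in> carrier A; b \<in> carrier A\<rbrakk> \<Longrightarrow> \<^bold>C (a \<^bold>\<or> b) = \<^bold>C a \<^bold>\<or> \<^bold>C b"
    and cl_zero: "\<^bold>C \<^bold>0 = \<^bold>0"
    and cl_increasing: "a \<in> carrier A \<Longrightarrow> a \<^bold>\<le> \<^bold>C a"
    and cl_idem: "a \<in> carrier A \<Longrightarrow> \<^bold>C (\<^bold>C a) = \<^bold>C a"
    and Fix: "fin_subset A \<Gamma>
      \<Longrightarrow> \<^bold>C\<^sup>t \<Gamma> \<^bold>\<le> \<^bold>\<And> ((\<lambda>\<gamma>. \<^bold>C (\<gamma> \<^bold>\<and> \<^bold>C\<^sup>t \<Gamma>)) ` \<Gamma>)"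
    and Ind: "\<lbrakk>fin_subset A \<Gamma>; a \<in> carrier A\<rbrakk>
      \<Longrightarrow> \<^bold>I (a \<^bold>\<Rightarrow> \<^bold>\<And> ((\<lambda>\<gamma>. \<^bold>C (\<gamma> \<^bold>\<and> a)) ` \<Gamma>)) \<^bold>\<and> a \<^bold>\<le> \<^bold>C\<^sup>t \<Gamma>"

definition tca_hom ::
    "('a, 'm) tangle_alg_scheme \<Rightarrow> ('b, 'n) tangle_alg_scheme \<Rightarrow> ('a \<Rightarrow> 'b) \<Rightarrow> bool" where
  "tca_hom A B f \<longleftrightarrow>
     ba_hom A B f \<and> (\<forall>\<Gamma>. fin_subset A \<Gamma> \<longrightarrow> f (\<^bold>C\<^sup>t\<^bsub>A\<^esub> \<Gamma>) = \<^bold>C\<^sup>t\<^bsub>B\<^esub> (f ` \<Gamma>))"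


section \<open>Free tangled closure algebras\<close>

definition tca_subuniverse :: "('a, 'm) tangle_alg_scheme \<Rightarrow> 'a set \<Rightarrow> bool" where
  "tca_subuniverse A S \<longleftrightarrow>
     S \<subseteq> carrier A \<and> \<^bold>0\<^bsub>A\<^esub> \<in> S \<and> \<^bold>1\<^bsub>A\<^esub> \<in> S \<and>
     (\<forall>a\<in>S. \<^bold>-\<^bsub>A\<^esub> a \<in> S) \<and>
     (\<forall>a\<in>S. \<forall>b\<in>S. a \<^bold>\<and>\<^bsub>A\<^esub> b \<in> S \<and> a \<^bold>\<or>\<^bsub>A\<^esub> b \<in> S) \<and>
     (\<forall>\<Gamma>. finite \<Gamma> \<and> \<Gamma> \<noteq> {} \<and> \<Gamma> \<subseteq> S \<longrightarrow> \<^bold>C\<^sup>t\<^bsub>A\<^esub> \<Gamma> \<in> S)"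

definition tca_generated_by :: "('a, 'm) tangle_alg_scheme \<Rightarrow> 'a set \<Rightarrow> bool" where
  "tca_generated_by A V \<longleftrightarrow>
     V \<subseteq> carrier A \<and> (\<forall>S. tca_subuniverse A S \<and> V \<subseteq> S \<longrightarrow> S = carrier A)"

definition unique_extension ::
    "('a, 'm) tangle_alg_scheme \<Rightarrow> 'a set \<Rightarrow> ('b, 'n) tangle_alg_scheme \<Rightarrow> ('a \<Rightarrow> 'b) \<Rightarrow> bool" where
  "unique_extension A V B g \<longleftrightarrow>
     (\<exists>!f. f \<in> extensional (carrier A) \<and> tca_hom A B f \<and> (\<forall>v\<in>V. f v = g v))"

text \<open>
  A formula cannot quantify over all types, so the universal property is stated for the algebras
  whose carrier is a set of natural numbers, that is, up to isomorphism, for the countable algebras.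
  For countable sets of generators this is no restriction: the theorem
  \<open>countably_free_tca_universal\<close> below derives the universal property for tangled closure algebras
  over an arbitrary type.
\<close>

definition countably_free_tca :: "('a, 'm) tangle_alg_scheme \<Rightarrow> 'a set \<Rightarrow> bool" where
  "countably_free_tca A V \<longleftrightarrow>
     countable V \<and> tangled_closure_algebra A \<and> tca_generated_by A V \<and>
     (\<forall>(B :: nat tangle_alg) g. tangled_closure_algebra B \<and> g \<in> V \<rightarrow> carrier B
        \<longrightarrow> unique_extension A V B g)"

lemma ba_order_simps [simp]:
  "carrier (ba_order A) = carrier A"
  "a .=\<^bsub>ba_order A\<^esub> b \<longleftrightarrow> a = b"
  "a \<^bold>\<le>\<^bsub>A\<^esub> b \<longleftrightarrow> a \<^bold>\<and>\<^bsub>A\<^esub> b = a"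
  by (simp_all add: ba_order_def)

lemma (in boolean_alg) meet_idem: "a \<in> carrier A \<Longrightarrow> a \<^bold>\<and> a = a"
  by (metis join_meet_absorb meet_closed meet_join_absorb)

lemma (in boolean_alg) partial_order_ba_order: "partial_order (ba_order A)"
proof
  show "x \<^bold>\<le> z" if "x \<^bold>\<le> y" "y \<^bold>\<le> z" "x \<in> carrier (ba_order A)" "y \<in> carrier (ba_order A)"
    "z \<in> carrier (ba_order A)" for x y z
    using that meet_assoc[of x y z] by simp
  show "x .=\<^bsub>ba_order A\<^esub> y" if "x \<^bold>\<le> y" "y \<^bold>\<le> x" "x \<in> carrier (ba_order A)"
    "y \<in> carrier (ba_order A)" for x y
    using that meet_comm[of x y] by simp
qed (auto simp: meet_idem ba_order_def)

lemma (in boolean_alg) is_glb_iff: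
  "T \<subseteq> carrier A \<Longrightarrow> is_glb (ba_order A) m T \<longleftrightarrow>
     m \<in> carrier A \<and> (\<forall>t\<in>T. m \<^bold>\<and> t = m) \<and>
     (\<forall>l\<in>carrier A. (\<forall>t\<in>T. l \<^bold>\<and> t = l) \<longrightarrow> l \<^bold>\<and> m = l)"
  by (simp add: greatest_def Lower_def subset_iff Ball_def) blast

lemma (in boolean_alg) Meet_eqI: "is_glb (ba_order A) m T \<Longrightarrow> \<^bold>\<And> T = m"
  unfolding Lattice.inf_def
  by (meson partial_order.greatest_unique partial_order_ba_order someI_ex)

lemma (in boolean_alg) finite_Meet_in:
  assumes "S \<subseteq> carrier A" and closed: "\<And>a b. \<lbrakk>a \<in> S; b \<in> S\<rbrakk> \<Longrightarrow> a \<^bold>\<and> b \<in> S"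
    and "finite T" "T \<noteq> {}" "T \<subseteq> S"
  shows "\<^bold>\<And> T \<in> S \<and> is_glb (ba_order A) (\<^bold>\<And> T) T"
proof -
  have "\<exists>m\<in>S. is_glb (ba_order A) m T"
    using \<open>finite T\<close> \<open>T \<noteq> {}\<close> \<open>T \<subseteq> S\<close>
  proof (induction rule: finite_ne_induct)
    case (singleton x)
    then show ?case using assms(1) by (intro bexI[of _ x]) (auto simp: is_glb_iff meet_idem)
  next
    case (insert x T)
    then obtain m where m: "m \<in> S" "is_glb (ba_order A) m T" by auto
    have T: "T \<subseteq> carrier A" "x \<in> carrier A" "m \<in> carrier A" "x \<in> S"
      using insert.prems assms(1) m(1) by auto
    note g = m(2)[unfolded is_glb_iff[OF T(1)]]
    have "is_glb (ba_order A) (x \<^bold>\<and> m) (insert x T)"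
    proof (subst is_glb_iff)
      have 1: "x \<^bold>\<and> m \<^bold>\<and> x = x \<^bold>\<and> m"
        by (metis T(2,3) meet_assoc meet_comm meet_idem)
      have 2: "x \<^bold>\<and> m \<^bold>\<and> t = x \<^bold>\<and> m" if "t \<in> T" for t
        using that g T meet_assoc[of x m t] by auto
      have 3: "l \<^bold>\<and> (x \<^bold>\<and> m) = l" if "l \<in> carrier A" "\<forall>t\<in>insert x T. l \<^bold>\<and> t = l" for l
        using that g T meet_assoc[of l x m] by auto
      show "x \<^bold>\<and> m \<in> carrier A \<and> (\<forall>t\<in>insert x T. x \<^bold>\<and> m \<^bold>\<and> t = x \<^bold>\<and> m) \<and>
          (\<forall>l\<in>carrier A. (\<forall>t\<in>insert x T. l \<^bold>\<and> t = l) \<longrightarrow> l \<^bold>\<and> (x \<^bold>\<and> m) = l)"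
        using 1 2 3 T meet_closed by auto
    qed (use T in auto)
    then show ?case using closed T(4) m(1) by blast
  qed
  then show ?thesis using Meet_eqI by blast
qed

definition transport_tca :: "'b set \<Rightarrow> ('b \<Rightarrow> 'c) \<Rightarrow> ('b, 'm) tangle_alg_scheme \<Rightarrow> 'c tangle_alg" where
  "transport_tca S h B =
     (let k = inv_into S h in
      \<lparr>carrier = h ` S,
       bmeet = (\<lambda>a b. h (k a \<^bold>\<and>\<^bsub>B\<^esub> k b)), bjoin = (\<lambda>a b. h (k a \<^bold>\<or>\<^bsub>B\<^esub> k b)),
       bcompl = (\<lambda>a. h (\<^bold>-\<^bsub>B\<^esub> k a)), bzero = h \<^bold>0\<^bsub>B\<^esub>, bone = h \<^bold>1\<^bsub>B\<^esub>,
       tangle = (\<lambda>\<Gamma>. h (\<^bold>C\<^sup>t\<^bsub>B\<^esub> (k ` \<Gamma>)))\<rparr>)"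

lemma transport_tca:
  assumes "tangled_closure_algebra B" and sub: "tca_subuniverse B S" and inj: "inj_on h S"
  shows "tangled_closure_algebra (transport_tca S h B)"
    and "tca_hom (transport_tca S h B) B (inv_into S h)"
proof -
  interpret B: tangled_closure_algebra B by fact
  let ?N = "transport_tca S h B" and ?k = "inv_into S h"
  have k: "?k (h a) = a" if "a \<in> S" for a using inj that by simp
  have kim: "?k ` h ` T = T" if "T \<subseteq> S" for T
    using that k by (force simp: image_image)
  have SB: "a \<in> carrier B" if "a \<in> S" for a
    using sub that by (auto simp: tca_subuniverse_def)
  note SC = sub[unfolded tca_subuniverse_def]
  have cl_S: "\<^bold>C\<^bsub>B\<^esub> a \<in> S" if "a \<in> S" for a
    using SC that by (auto simp: cl_def)
  have imp_S: "a \<^bold>\<Rightarrow>\<^bsub>B\<^esub> b \<in> S" if "a \<in> S" "b \<in> S" for a b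
    using SC that by auto
  have itr_S: "\<^bold>I\<^bsub>B\<^esub> a \<in> S" if "a \<in> S" for a
    using SC that by (auto simp: itr_def)
  have car: "carrier ?N = h ` S" by (simp add: transport_tca_def Let_def)
  have ops: "h a \<^bold>\<and>\<^bsub>?N\<^esub> h b = h (a \<^bold>\<and>\<^bsub>B\<^esub> b)" "h a \<^bold>\<or>\<^bsub>?N\<^esub> h b = h (a \<^bold>\<or>\<^bsub>B\<^esub> b)"
    if "a \<in> S" "b \<in> S" for a b
    using that by (simp_all add: transport_tca_def Let_def k)
  have ops1: "\<^bold>-\<^bsub>?N\<^esub> h a = h (\<^bold>-\<^bsub>B\<^esub> a)" if "a \<in> S" for a
    using that by (simp add: transport_tca_def Let_def k)
  note ops = ops ops1
  have zero_one: "\<^bold>0\<^bsub>?N\<^esub> = h \<^bold>0\<^bsub>B\<^esub>" "\<^bold>1\<^bsub>?N\<^esub> = h \<^bold>1\<^bsub>B\<^esub>"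
    by (simp_all add: transport_tca_def Let_def)
  have tan: "\<^bold>C\<^sup>t\<^bsub>?N\<^esub> (h ` T) = h (\<^bold>C\<^sup>t\<^bsub>B\<^esub> T)" if "T \<subseteq> S" for T
    using kim[OF that] by (simp add: transport_tca_def Let_def)
  have cl: "\<^bold>C\<^bsub>?N\<^esub> (h a) = h (\<^bold>C\<^bsub>B\<^esub> a)" if "a \<in> S" for a
    using tan[of "{a}"] that by (simp add: cl_def)
  have itr: "\<^bold>I\<^bsub>?N\<^esub> (h a) = h (\<^bold>I\<^bsub>B\<^esub> a)" if "a \<in> S" for a
    using tan[of "{\<^bold>-\<^bsub>B\<^esub> a}"] that SC by (simp add: itr_def ops)
  have S: "a \<^bold>\<and>\<^bsub>B\<^esub> b \<in> S" "a \<^bold>\<or>\<^bsub>B\<^esub> b \<in> S" if "a \<in> S" "b \<in> S" for a b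
    using SC that by auto
  have S1: "\<^bold>-\<^bsub>B\<^esub> a \<in> S" if "a \<in> S" for a using SC that by auto
  note S = S S1
  have S': "\<^bold>0\<^bsub>B\<^esub> \<in> S" "\<^bold>1\<^bsub>B\<^esub> \<in> S" using SC by auto
  have N: "boolean_alg ?N"
  proof
    fix a b c assume "a \<in> carrier ?N" "b \<in> carrier ?N" "c \<in> carrier ?N"
    then obtain a' b' c' where "a = h a'" "b = h b'" "c = h c'" "a' \<in> S" "b' \<in> S" "c' \<in> S"
      by (auto simp: car)
    then show "(a \<^bold>\<and>\<^bsub>?N\<^esub> b) \<^bold>\<and>\<^bsub>?N\<^esub> c = a \<^bold>\<and>\<^bsub>?N\<^esub> (b \<^bold>\<and>\<^bsub>?N\<^esub> c)"
      "(a \<^bold>\<or>\<^bsub>?N\<^esub> b) \<^bold>\<or>\<^bsub>?N\<^esub> c = a \<^bold>\<or>\<^bsub>?N\<^esub> (b \<^bold>\<or>\<^bsub>?N\<^esub> c)"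
      "a \<^bold>\<and>\<^bsub>?N\<^esub> (b \<^bold>\<or>\<^bsub>?N\<^esub> c) = (a \<^bold>\<and>\<^bsub>?N\<^esub> b) \<^bold>\<or>\<^bsub>?N\<^esub> (a \<^bold>\<and>\<^bsub>?N\<^esub> c)"
      "a \<^bold>\<or>\<^bsub>?N\<^esub> (b \<^bold>\<and>\<^bsub>?N\<^esub> c) = (a \<^bold>\<or>\<^bsub>?N\<^esub> b) \<^bold>\<and>\<^bsub>?N\<^esub> (a \<^bold>\<or>\<^bsub>?N\<^esub> c)"
      using B.meet_assoc[of a' b' c'] B.join_assoc[of a' b' c']
        B.meet_join_distrib[of a' b' c'] B.join_meet_distrib[of a' b' c']
      by (simp_all add: ops S SB)
  next
    fix a b assume "a \<in> carrier ?N" "b \<in> carrier ?N"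
    then obtain a' b' where ab: "a = h a'" "b = h b'" "a' \<in> S" "b' \<in> S"
      by (auto simp: car)
    show "a \<^bold>\<and>\<^bsub>?N\<^esub> b = b \<^bold>\<and>\<^bsub>?N\<^esub> a" "a \<^bold>\<or>\<^bsub>?N\<^esub> b = b \<^bold>\<or>\<^bsub>?N\<^esub> a"
      using ab B.meet_comm[of a' b'] B.join_comm[of a' b'] by (simp_all add: ops SB)
    from ab show "a \<^bold>\<and>\<^bsub>?N\<^esub> b \<in> carrier ?N" "a \<^bold>\<or>\<^bsub>?N\<^esub> b \<in> carrier ?N"
      "a \<^bold>\<and>\<^bsub>?N\<^esub> (a \<^bold>\<or>\<^bsub>?N\<^esub> b) = a" "a \<^bold>\<or>\<^bsub>?N\<^esub> (a \<^bold>\<and>\<^bsub>?N\<^esub> b) = a"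
      by (simp_all add: ops S SB car B.meet_join_absorb B.join_meet_absorb)
  next
    fix a assume "a \<in> carrier ?N"
    then obtain a' where "a = h a'" "a' \<in> S" by (auto simp: car)
    then show "\<^bold>-\<^bsub>?N\<^esub> a \<in> carrier ?N"
      "a \<^bold>\<and>\<^bsub>?N\<^esub> \<^bold>1\<^bsub>?N\<^esub> = a" "a \<^bold>\<or>\<^bsub>?N\<^esub> \<^bold>0\<^bsub>?N\<^esub> = a"
      "a \<^bold>\<and>\<^bsub>?N\<^esub> \<^bold>-\<^bsub>?N\<^esub> a = \<^bold>0\<^bsub>?N\<^esub>" "a \<^bold>\<or>\<^bsub>?N\<^esub> \<^bold>-\<^bsub>?N\<^esub> a = \<^bold>1\<^bsub>?N\<^esub>"
      by (simp_all add: ops zero_one S S' SB car B.meet_one B.join_zero B.meet_compl B.join_compl)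
  qed (simp_all add: car zero_one S')
  interpret N: boolean_alg ?N by fact
  have S_meet: "\<^bold>\<And>\<^bsub>B\<^esub> T \<in> S" "\<^bold>\<And>\<^bsub>?N\<^esub> (h ` T) = h (\<^bold>\<And>\<^bsub>B\<^esub> T)"
    if "finite T" "T \<noteq> {}" "T \<subseteq> S" for T
  proof -
    have m: "\<^bold>\<And>\<^bsub>B\<^esub> T \<in> S \<and> is_glb (ba_order B) (\<^bold>\<And>\<^bsub>B\<^esub> T) T"
      using B.finite_Meet_in[of S T] that SB S by blast
    then show 1: "\<^bold>\<And>\<^bsub>B\<^esub> T \<in> S" by blast
    have T: "T \<subseteq> carrier B" using that SB by blast
    have inj': "h a = h b \<longleftrightarrow> a = b" if "a \<in> S" "b \<in> S" for a b
      using that inj by (auto dest: inj_onD)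
    have TS: "t \<in> S" if "t \<in> T" for t using that \<open>T \<subseteq> S\<close> by blast
    have "is_glb (ba_order ?N) (h (\<^bold>\<And>\<^bsub>B\<^esub> T)) (h ` T)"
      using m[unfolded B.is_glb_iff[OF T]] that(3) 1
      by (subst N.is_glb_iff) (auto simp: car ops S inj' TS SB)
    then show "\<^bold>\<And>\<^bsub>?N\<^esub> (h ` T) = h (\<^bold>\<And>\<^bsub>B\<^esub> T)" by (rule N.Meet_eqI)
  qed
  have fin: "\<exists>T. finite T \<and> T \<noteq> {} \<and> T \<subseteq> S \<and> \<Gamma> = h ` T" if "fin_subset ?N \<Gamma>" for \<Gamma>
    using that finite_subset_image[of \<Gamma> h S] by (auto simp: fin_subset_def car)
  have finB: "fin_subset B T" if "finite T" "T \<noteq> {}" "T \<subseteq> S" for T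
    using that SB by (auto simp: fin_subset_def)
  have tan_S: "\<^bold>C\<^sup>t\<^bsub>B\<^esub> T \<in> S" if "finite T" "T \<noteq> {}" "T \<subseteq> S" for T
    using that SC by blast
  have img: "\<^bold>\<And>\<^bsub>?N\<^esub> ((\<lambda>\<gamma>. \<^bold>C\<^bsub>?N\<^esub> (\<gamma> \<^bold>\<and>\<^bsub>?N\<^esub> h a)) ` h ` T)
        = h (\<^bold>\<And>\<^bsub>B\<^esub> ((\<lambda>\<gamma>. \<^bold>C\<^bsub>B\<^esub> (\<gamma> \<^bold>\<and>\<^bsub>B\<^esub> a)) ` T))"
    and img_S: "\<^bold>\<And>\<^bsub>B\<^esub> ((\<lambda>\<gamma>. \<^bold>C\<^bsub>B\<^esub> (\<gamma> \<^bold>\<and>\<^bsub>B\<^esub> a)) ` T) \<in> S"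
    if "finite T" "T \<noteq> {}" "T \<subseteq> S" "a \<in> S" for T a
  proof -
    have *: "(\<lambda>\<gamma>. \<^bold>C\<^bsub>B\<^esub> (\<gamma> \<^bold>\<and>\<^bsub>B\<^esub> a)) ` T \<subseteq> S"
      using that cl_S S by blast
    have "(\<lambda>\<gamma>. \<^bold>C\<^bsub>?N\<^esub> (\<gamma> \<^bold>\<and>\<^bsub>?N\<^esub> h a)) ` h ` T = h ` (\<lambda>\<gamma>. \<^bold>C\<^bsub>B\<^esub> (\<gamma> \<^bold>\<and>\<^bsub>B\<^esub> a)) ` T"
      unfolding image_image
    proof (rule image_cong[OF refl])
      fix x assume "x \<in> T"
      then have "x \<in> S" using that by blast
      then show "\<^bold>C\<^bsub>?N\<^esub> (h x \<^bold>\<and>\<^bsub>?N\<^esub> h a) = h (\<^bold>C\<^bsub>B\<^esub> (x \<^bold>\<and>\<^bsub>B\<^esub> a))"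
        using that cl S by (simp add: ops)
    qed
    then show "\<^bold>\<And>\<^bsub>?N\<^esub> ((\<lambda>\<gamma>. \<^bold>C\<^bsub>?N\<^esub> (\<gamma> \<^bold>\<and>\<^bsub>?N\<^esub> h a)) ` h ` T)
        = h (\<^bold>\<And>\<^bsub>B\<^esub> ((\<lambda>\<gamma>. \<^bold>C\<^bsub>B\<^esub> (\<gamma> \<^bold>\<and>\<^bsub>B\<^esub> a)) ` T))"
      using S_meet(2)[OF _ _ *] that by simp
    show "\<^bold>\<And>\<^bsub>B\<^esub> ((\<lambda>\<gamma>. \<^bold>C\<^bsub>B\<^esub> (\<gamma> \<^bold>\<and>\<^bsub>B\<^esub> a)) ` T) \<in> S"
      using S_meet(1)[OF _ _ *] that by simp
  qed
  show "tangled_closure_algebra ?N"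
  proof
    fix \<Gamma> assume "fin_subset ?N \<Gamma>"
    then obtain T where T: "finite T" "T \<noteq> {}" "T \<subseteq> S" "\<Gamma> = h ` T" using fin by blast
    note TS = tan_S[OF T(1-3)]
    show "\<^bold>C\<^sup>t\<^bsub>?N\<^esub> \<Gamma> \<in> carrier ?N"
      using TS by (simp add: T(4) tan[OF T(3)] car)
    show "\<^bold>C\<^sup>t\<^bsub>?N\<^esub> \<Gamma> \<^bold>\<le>\<^bsub>?N\<^esub> \<^bold>\<And>\<^bsub>?N\<^esub> ((\<lambda>\<gamma>. \<^bold>C\<^bsub>?N\<^esub> (\<gamma> \<^bold>\<and>\<^bsub>?N\<^esub> \<^bold>C\<^sup>t\<^bsub>?N\<^esub> \<Gamma>)) ` \<Gamma>)"
      using B.Fix[OF finB[OF T(1-3)]]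
      by (simp add: T(4) tan[OF T(3)] img[OF T(1-3) TS] ops img_S[OF T(1-3) TS] TS)
    fix a assume "a \<in> carrier ?N"
    then obtain b where b: "b \<in> S" "a = h b" by (auto simp: car)
    let ?m = "\<^bold>\<And>\<^bsub>B\<^esub> ((\<lambda>\<gamma>. \<^bold>C\<^bsub>B\<^esub> (\<gamma> \<^bold>\<and>\<^bsub>B\<^esub> b)) ` T)"
    have m: "?m \<in> S" by (rule img_S[OF T(1-3) b(1)])
    then have m': "b \<^bold>\<Rightarrow>\<^bsub>B\<^esub> ?m \<in> S" using b imp_S by blast
    show "\<^bold>I\<^bsub>?N\<^esub> (a \<^bold>\<Rightarrow>\<^bsub>?N\<^esub> \<^bold>\<And>\<^bsub>?N\<^esub> ((\<lambda>\<gamma>. \<^bold>C\<^bsub>?N\<^esub> (\<gamma> \<^bold>\<and>\<^bsub>?N\<^esub> a)) ` \<Gamma>)) \<^bold>\<and>\<^bsub>?N\<^esub> a \<^bold>\<le>\<^bsub>?N\<^esub> \<^bold>C\<^sup>t\<^bsub>?N\<^esub> \<Gamma>"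
      using B.Ind[OF finB[OF T(1-3)] SB[OF b(1)]] b(1) m
      by (simp add: T(4) b(2) tan[OF T(3)] img[OF T(1-3) b(1)] ops S m itr[OF m'] itr_S[OF m'] TS)
  next
    fix a b assume "a \<in> carrier ?N" "b \<in> carrier ?N"
    then show "\<^bold>C\<^bsub>?N\<^esub> (a \<^bold>\<or>\<^bsub>?N\<^esub> b) = \<^bold>C\<^bsub>?N\<^esub> a \<^bold>\<or>\<^bsub>?N\<^esub> \<^bold>C\<^bsub>?N\<^esub> b"
      by (auto simp: car ops cl S cl_S SB B.cl_join)
  next
    fix a assume "a \<in> carrier ?N"
    then show "a \<^bold>\<le>\<^bsub>?N\<^esub> \<^bold>C\<^bsub>?N\<^esub> a" "\<^bold>C\<^bsub>?N\<^esub> (\<^bold>C\<^bsub>?N\<^esub> a) = \<^bold>C\<^bsub>?N\<^esub> a"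
      using B.cl_increasing by (auto simp: car ops cl cl_S SB B.cl_idem)
  next
    show "\<^bold>C\<^bsub>?N\<^esub> \<^bold>0\<^bsub>?N\<^esub> = \<^bold>0\<^bsub>?N\<^esub>"
      by (simp add: zero_one cl S' B.cl_zero)
  qed
  have "?k (\<^bold>C\<^sup>t\<^bsub>?N\<^esub> \<Gamma>) = \<^bold>C\<^sup>t\<^bsub>B\<^esub> (?k ` \<Gamma>)" if "fin_subset ?N \<Gamma>" for \<Gamma>
    using fin[OF that] tan kim tan_S k by force
  then show "tca_hom ?N B ?k"
    by (auto simp: tca_hom_def ba_hom_def car ops zero_one k S S' SB)
qed

lemma countable_subuniverse:
  assumes "tangled_closure_algebra B" "countable G" "G \<subseteq> carrier B"
  shows "\<exists>S. countable S \<and> G \<subseteq> S \<and> tca_subuniverse B S"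
proof -
  interpret B: tangled_closure_algebra B by fact
  define step where "step X = X \<union> {\<^bold>0\<^bsub>B\<^esub>, \<^bold>1\<^bsub>B\<^esub>} \<union> bcompl B ` X
    \<union> (\<lambda>(a, b). a \<^bold>\<and>\<^bsub>B\<^esub> b) ` (X \<times> X) \<union> (\<lambda>(a, b). a \<^bold>\<or>\<^bsub>B\<^esub> b) ` (X \<times> X)
    \<union> tangle B ` {\<Gamma>. \<Gamma> \<noteq> {} \<and> \<Gamma> \<in> {\<Gamma>. finite \<Gamma> \<and> \<Gamma> \<subseteq> X}}" for X
  define F where "F n = (step ^^ n) G" for n
  have F0: "F 0 = G" and FS: "F (Suc n) = step (F n)" for n by (simp_all add: F_def)
  have cnt: "countable (F n)" for n
  proof (induction n)
    case (Suc n)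
    have "countable {\<Gamma>. \<Gamma> \<noteq> {} \<and> \<Gamma> \<in> {\<Gamma>. finite \<Gamma> \<and> \<Gamma> \<subseteq> F n}}"
      using countable_Collect_finite_subset[OF Suc]
      by (rule countable_subset[rotated]) auto
    then show ?case unfolding FS step_def using Suc by auto
  qed (simp add: F0 assms)
  have car: "F n \<subseteq> carrier B" for n
  proof (induction n)
    case (Suc n)
    then show ?case unfolding FS step_def
      by (auto simp: B.zero_closed B.one_closed subset_iff fin_subset_def
          intro!: B.compl_closed B.meet_closed B.join_closed B.tangle_closed)
  qed (simp add: F0 assms)
  have mono: "F m \<subseteq> F n" if "m \<le> n" for m n
    using that by (rule lift_Suc_mono_le[of F, rotated]) (auto simp: FS step_def)
  have finF: "\<exists>n. \<Gamma> \<subseteq> F n" if "finite \<Gamma>" "\<Gamma> \<subseteq> (\<Union>n. F n)" for \<Gamma>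
    using that
  proof (induction rule: finite_induct)
    case (insert x \<Gamma>)
    then obtain m n where "\<Gamma> \<subseteq> F n" "x \<in> F m" by auto
    then have "insert x \<Gamma> \<subseteq> F (max m n)"
      using mono[of m "max m n"] mono[of n "max m n"] by auto
    then show ?case by blast
  qed auto
  have "tca_subuniverse B (\<Union>n. F n)"
    unfolding tca_subuniverse_def
  proof (intro conjI ballI allI impI)
    show "(\<Union>n. F n) \<subseteq> carrier B" using car by blast
    have "\<^bold>0\<^bsub>B\<^esub> \<in> F (Suc 0)" "\<^bold>1\<^bsub>B\<^esub> \<in> F (Suc 0)" by (simp_all add: FS step_def)
    then show "\<^bold>0\<^bsub>B\<^esub> \<in> (\<Union>n. F n)" "\<^bold>1\<^bsub>B\<^esub> \<in> (\<Union>n. F n)" by blast+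
  next
    fix a assume "a \<in> (\<Union>n. F n)"
    then obtain n where "a \<in> F n" by blast
    then have "\<^bold>-\<^bsub>B\<^esub> a \<in> F (Suc n)" by (simp add: FS step_def)
    then show "\<^bold>-\<^bsub>B\<^esub> a \<in> (\<Union>n. F n)" by blast
  next
    fix a b assume "a \<in> (\<Union>n. F n)" "b \<in> (\<Union>n. F n)"
    then obtain n where n: "a \<in> F n" "b \<in> F n" using finF[of "{a, b}"] by auto
    have "a \<^bold>\<and>\<^bsub>B\<^esub> b \<in> F (Suc n)" "a \<^bold>\<or>\<^bsub>B\<^esub> b \<in> F (Suc n)"
      unfolding FS step_def using n by force+
    then show "a \<^bold>\<and>\<^bsub>B\<^esub> b \<in> (\<Union>n. F n)" "a \<^bold>\<or>\<^bsub>B\<^esub> b \<in> (\<Union>n. F n)" by blast+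
  next
    fix \<Gamma> assume \<Gamma>: "finite \<Gamma> \<and> \<Gamma> \<noteq> {} \<and> \<Gamma> \<subseteq> (\<Union>n. F n)"
    then obtain n where "\<Gamma> \<subseteq> F n" using finF by blast
    then have "\<^bold>C\<^sup>t\<^bsub>B\<^esub> \<Gamma> \<in> F (Suc n)" unfolding FS step_def using \<Gamma> by auto
    then show "\<^bold>C\<^sup>t\<^bsub>B\<^esub> \<Gamma> \<in> (\<Union>n. F n)" by blast
  qed
  moreover have "G \<subseteq> (\<Union>n. F n)" using F0 by blast
  ultimately show ?thesis using cnt by (intro exI[of _ "\<Union>n. F n"]) simp
qed

lemma tca_hom_unique:
  assumes "tangled_closure_algebra A" "tca_generated_by A V" "tca_hom A B f" "tca_hom A B f'"
    and "\<forall>v\<in>V. f v = f' v" and "a \<in> carrier A"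
  shows "f a = f' a"
proof -
  interpret A: tangled_closure_algebra A by fact
  let ?S = "{a \<in> carrier A. f a = f' a}"
  have "\<^bold>C\<^sup>t\<^bsub>A\<^esub> \<Gamma> \<in> ?S" if "finite \<Gamma> \<and> \<Gamma> \<noteq> {} \<and> \<Gamma> \<subseteq> ?S" for \<Gamma>
  proof -
    have \<Gamma>: "fin_subset A \<Gamma>" and "f ` \<Gamma> = f' ` \<Gamma>"
      using that by (auto simp: fin_subset_def intro!: image_cong)
    then show ?thesis using assms(3,4) A.tangle_closed by (auto simp: tca_hom_def)
  qed
  moreover have "\<^bold>0\<^bsub>A\<^esub> \<in> ?S" "\<^bold>1\<^bsub>A\<^esub> \<in> ?S"
    "\<forall>a\<in>?S. \<^bold>-\<^bsub>A\<^esub> a \<in> ?S" "\<forall>a\<in>?S. \<forall>b\<in>?S. a \<^bold>\<and>\<^bsub>A\<^esub> b \<in> ?S \<and> a \<^bold>\<or>\<^bsub>A\<^esub> b \<in> ?S"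
    using assms(3,4)
    by (simp_all add: tca_hom_def ba_hom_def A.zero_closed A.one_closed A.compl_closed
        A.meet_closed A.join_closed)
  ultimately have "tca_subuniverse A ?S"
    unfolding tca_subuniverse_def by blast
  moreover have "V \<subseteq> ?S" using assms(2,5) by (auto simp: tca_generated_by_def)
  ultimately show ?thesis using assms(2,6) unfolding tca_generated_by_def by blast
qed

lemma tca_hom_compose:
  assumes "tca_hom A B f" "tca_hom B C g"
  shows "tca_hom A C (g \<circ> f)"
proof -
  have "fin_subset B (f ` \<Gamma>)" if "fin_subset A \<Gamma>" for \<Gamma>
    using that assms(1) by (auto simp: tca_hom_def ba_hom_def fin_subset_def)
  then show ?thesis
    using assms by (simp add: tca_hom_def ba_hom_def Pi_iff image_comp)
qed

lemma tca_hom_restrict: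
  assumes "tangled_closure_algebra A" "tca_hom A B f"
  shows "tca_hom A B (restrict f (carrier A))"
proof -
  interpret A: tangled_closure_algebra A by fact
  have "restrict f (carrier A) ` \<Gamma> = f ` \<Gamma>" if "fin_subset A \<Gamma>" for \<Gamma>
    using that by (auto simp: fin_subset_def intro!: image_cong)
  then show ?thesis
    using assms(2) by (simp add: tca_hom_def ba_hom_def Pi_iff A.zero_closed A.one_closed
        A.compl_closed A.meet_closed A.join_closed A.tangle_closed)
qed

theorem countably_free_tca_universal:
  fixes A :: "('a, 'm) tangle_alg_scheme" and B :: "('b, 'n) tangle_alg_scheme"
  assumes "countably_free_tca A V" and "tangled_closure_algebra B" and "g \<in> V \<rightarrow> carrier B"
  shows "unique_extension A V B g"
proof -
  have A: "tangled_closure_algebra A" "tca_generated_by A V" "countable V"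
    using assms(1) by (auto simp: countably_free_tca_def)
  have V: "V \<subseteq> carrier A" using A(2) by (simp add: tca_generated_by_def)
  obtain S where S: "countable S" "g ` V \<subseteq> S" "tca_subuniverse B S"
    using countable_subuniverse[OF assms(2), of "g ` V"] A(3) assms(3) by auto
  let ?h = "to_nat_on S"
  have inj: "inj_on ?h S" using S(1) by (rule inj_on_to_nat_on)
  let ?N = "transport_tca S ?h B"
  note N = transport_tca[OF assms(2) S(3) inj]
  have "?h \<circ> g \<in> V \<rightarrow> carrier ?N"
    using S(2) by (auto simp: transport_tca_def Let_def)
  then have "unique_extension A V ?N (?h \<circ> g)"
    using assms(1) N(1) unfolding countably_free_tca_def by blast
  then obtain f where f: "tca_hom A ?N f" "\<forall>v\<in>V. f v = ?h (g v)"
    unfolding unique_extension_def by auto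
  let ?f = "restrict (inv_into S ?h \<circ> f) (carrier A)"
  have "tca_hom A B ?f"
    using tca_hom_restrict[OF A(1) tca_hom_compose[OF f(1) N(2)]] .
  moreover have "\<forall>v\<in>V. ?f v = g v"
    using f(2) V S(2) inj by (auto simp: subset_iff image_subset_iff)
  moreover have "f' = ?f" if "f' \<in> extensional (carrier A)" "tca_hom A B f'" "\<forall>v\<in>V. f' v = g v" for f'
  proof (rule extensionalityI[OF that(1) restrict_extensional])
    show "f' a = ?f a" if "a \<in> carrier A" for a
      using tca_hom_unique[OF A(1,2) \<open>tca_hom A B f'\<close> \<open>tca_hom A B ?f\<close> _ that]
        \<open>\<forall>v\<in>V. f' v = g v\<close> \<open>\<forall>v\<in>V. ?f v = g v\<close> by simp
  qed
  ultimately show ?thesis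
    unfolding unique_extension_def by (intro ex1I[of _ ?f]) auto
qed

section \<open>The algebra of sets of ultrafilters above a given one\<close>

definition canonical_rel :: "('a, 'm) tangle_alg_scheme \<Rightarrow> 'a set \<Rightarrow> 'a set \<Rightarrow> bool" where
  "canonical_rel A x y \<longleftrightarrow> {a \<in> carrier A. \<^bold>I\<^bsub>A\<^esub> a \<in> x} \<subseteq> y"

definition successors :: "('a, 'm) tangle_alg_scheme \<Rightarrow> 'a set \<Rightarrow> 'a set set" where
  "successors A x\<^sub>0 = {y. ultrafilter A y \<and> canonical_rel A x\<^sub>0 y}"

definition bracket :: "('a, 'm) tangle_alg_scheme \<Rightarrow> 'a set \<Rightarrow> 'a \<Rightarrow> 'a set set" where
  "bracket A x\<^sub>0 a = {x \<in> successors A x\<^sub>0. a \<in> x}"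

definition bracket_alg :: "('a, 'm) tangle_alg_scheme \<Rightarrow> 'a set \<Rightarrow> 'a set set tangle_alg" where
  "bracket_alg A x\<^sub>0 =
     \<lparr>carrier = bracket A x\<^sub>0 ` carrier A,
      bmeet = (\<inter>), bjoin = (\<union>), bcompl = (\<lambda>X. successors A x\<^sub>0 - X),
      bzero = {}, bone = successors A x\<^sub>0,
      tangle = (\<lambda>\<Delta>. THE X. \<exists>\<Gamma>. fin_subset A \<Gamma> \<and> \<Delta> = bracket A x\<^sub>0 ` \<Gamma>
                                 \<and> X = bracket A x\<^sub>0 (\<^bold>C\<^sup>t\<^bsub>A\<^esub> \<Gamma>))\<rparr>"

definition base_ultrafilter ::
    "('a, 'm) tangle_alg_scheme \<Rightarrow> (nat \<Rightarrow> 'a) \<Rightarrow> 'a \<Rightarrow> 'a set \<Rightarrow> bool" where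
  "base_ultrafilter A p q x\<^sub>0 \<longleftrightarrow>
     ultrafilter A x\<^sub>0 \<and>
     \<^bold>C\<^sup>t\<^bsub>A\<^esub> {q, \<^bold>-\<^bsub>A\<^esub> q} \<notin> x\<^sub>0 \<and>
     {p 0} \<union>
     {\<^bold>I\<^bsub>A\<^esub> (p (2 * n) \<^bold>\<Rightarrow>\<^bsub>A\<^esub> \<^bold>C\<^bsub>A\<^esub> (p (2 * n + 1) \<^bold>\<and>\<^bsub>A\<^esub> q)) | n. True} \<union>
     {\<^bold>I\<^bsub>A\<^esub> (p (2 * n + 1) \<^bold>\<Rightarrow>\<^bsub>A\<^esub> \<^bold>C\<^bsub>A\<^esub> (p (2 * n + 2) \<^bold>\<and>\<^bsub>A\<^esub> \<^bold>-\<^bsub>A\<^esub> q)) | n. True}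
     \<subseteq> x\<^sub>0"

end

theory Submission
  imports Defs
begin

text \<open>
  In the algebra of sets we have \<open>[p\<^sub>2\<^sub>n] \<le> C([p\<^sub>2\<^sub>n\<^sub>+\<^sub>1] \<and> [q])\<close> and
  \<open>[p\<^sub>2\<^sub>n\<^sub>+\<^sub>1] \<le> C([p\<^sub>2\<^sub>n\<^sub>+\<^sub>2] \<and> -[q])\<close>.  Under an embedding \<open>f\<close> into a complete algebra, the join
  \<open>b\<close> of all \<open>f[p\<^sub>n]\<close> therefore satisfies \<open>b \<le> C(f[q] \<and> b) \<and> C(-f[q] \<and> b)\<close>, so the induction axiom
  yields \<open>f[p\<^sub>0] \<le> b \<le> f[C\<^sup>t{q,-q}]\<close>.  By injectivity \<open>[p\<^sub>0] \<subseteq> [C\<^sup>t{q,-q}]\<close>, which fails at \<open>x\<^sub>0\<close>.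

  The existence of \<open>x\<^sub>0\<close> is a compactness argument.  In the algebra of all subsets of the
  converse well-founded frame \<open>(\<nat>, \<ge>)\<close> every tangle of two disjoint sets is empty.  Interpreting \<open>p\<^sub>k\<close>
  as \<open>{2M - k}\<close> for \<open>k \<le> 2M\<close> and \<open>q\<close> as the set of odd numbers makes the requirements with
  index below \<open>2M\<close> true at the point \<open>2M\<close>.
\<close>

section \<open>Ultrafilters\<close>

text \<open>The whole carrier counts as a filter here. Properness is recovered later from an element
  that the filter avoids, so extending a filter needs no consistency check.\<close>

definition ba_filter :: "('a, 'm) bool_alg_scheme \<Rightarrow> 'a set \<Rightarrow> bool" where
  "ba_filter A F \<longleftrightarrow>
     F \<subseteq> carrier A \<and> \<^bold>1\<^bsub>A\<^esub> \<in> F \<and>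
     (\<forall>a\<in>F. \<forall>b\<in>carrier A. a \<^bold>\<le>\<^bsub>A\<^esub> b \<longrightarrow> b \<in> F) \<and>
     (\<forall>a\<in>F. \<forall>b\<in>F. a \<^bold>\<and>\<^bsub>A\<^esub> b \<in> F)"

context boolean_alg
begin

section \<open>Order facts, written as meet equations\<close>

lemma meet_le_trans:
  "\<lbrakk>a \<in> carrier A; b \<in> carrier A; c \<in> carrier A; a \<^bold>\<and> b = a; b \<^bold>\<and> c = b\<rbrakk> \<Longrightarrow> a \<^bold>\<and> c = a"
  by (metis meet_assoc)

lemma meet_lower:
  assumes "a \<in> carrier A" "b \<in> carrier A"
  shows "(a \<^bold>\<and> b) \<^bold>\<and> a = a \<^bold>\<and> b" "(a \<^bold>\<and> b) \<^bold>\<and> b = a \<^bold>\<and> b"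
  using assms by (metis meet_assoc meet_comm meet_idem)+

lemma meet_mono:
  assumes "a \<in> carrier A" "b \<in> carrier A" "c \<in> carrier A" "d \<in> carrier A"
    and "a \<^bold>\<and> b = a" "c \<^bold>\<and> d = c"
  shows "(a \<^bold>\<and> c) \<^bold>\<and> (b \<^bold>\<and> d) = a \<^bold>\<and> c"
  using assms by (smt (verit, best) meet_assoc meet_closed meet_comm)

lemma meet_zero: "a \<in> carrier A \<Longrightarrow> \<^bold>0 \<^bold>\<and> a = \<^bold>0"
  by (metis meet_assoc meet_comm meet_compl meet_idem compl_closed)

text \<open>By distributivity \<open>c\<close> is the join of its parts below \<open>b\<close> and
  below the complement of \<open>b\<close>. This is the case split that makes maximal filters
  ultra.\<close>

lemma le_by_cases:
  assumes "a \<in> carrier A" "b \<in> carrier A" "c \<in> carrier A"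
    and "(c \<^bold>\<and> b) \<^bold>\<and> a = c \<^bold>\<and> b" "(c \<^bold>\<and> \<^bold>- b) \<^bold>\<and> a = c \<^bold>\<and> \<^bold>- b"
  shows "c \<^bold>\<and> a = c"
proof -
  have c: "c = (c \<^bold>\<and> b) \<^bold>\<or> (c \<^bold>\<and> \<^bold>- b)"
    using assms(2,3) by (metis compl_closed join_compl meet_join_distrib meet_one)
  have "a \<^bold>\<and> c = (a \<^bold>\<and> (c \<^bold>\<and> b)) \<^bold>\<or> (a \<^bold>\<and> (c \<^bold>\<and> \<^bold>- b))"
    by (subst c) (simp add: assms meet_join_distrib meet_closed compl_closed)
  then show ?thesis
    using c assms by (metis compl_closed meet_closed meet_comm)
qed

section \<open>The ultrafilter theorem\<close>

text \<open>\<open>G\<close> is the filter generated by \<open>F\<close> and \<open>b\<close>. One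
  \<open>g\<close> from \<open>F\<close> suffices for each member because \<open>F\<close> is closed
  under meets.\<close>

lemma ba_filter_extend:
  assumes F: "ba_filter A F" and b: "b \<in> carrier A"
  defines "G \<equiv> {c \<in> carrier A. \<exists>g\<in>F. (g \<^bold>\<and> b) \<^bold>\<and> c = g \<^bold>\<and> b}"
  shows "ba_filter A G" "F \<subseteq> G" "b \<in> G"
proof -
  have Fc: "\<And>g. g \<in> F \<Longrightarrow> g \<in> carrier A" and F1: "\<^bold>1 \<in> F"
    and Fm: "\<And>g h. g \<in> F \<Longrightarrow> h \<in> F \<Longrightarrow> g \<^bold>\<and> h \<in> F"
    using F by (auto simp: ba_filter_def)
  show "F \<subseteq> G" using Fc b meet_lower by (auto simp: G_def)
  show "b \<in> G" using Fc F1 b meet_lower by (auto simp: G_def)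
  have up: "c \<in> G" if ac: "a \<in> G" "c \<in> carrier A" "a \<^bold>\<and> c = a" for a c
  proof -
    obtain g where g: "g \<in> F" "(g \<^bold>\<and> b) \<^bold>\<and> a = g \<^bold>\<and> b" "a \<in> carrier A"
      using ac(1) by (auto simp: G_def)
    then have "(g \<^bold>\<and> b) \<^bold>\<and> c = g \<^bold>\<and> b"
      using meet_le_trans[of "g \<^bold>\<and> b" a c] ac(2,3) meet_closed[OF Fc b] by blast
    then show ?thesis using g(1) ac(2) by (auto simp: G_def)
  qed
  have meet: "a \<^bold>\<and> c \<in> G" if ac: "a \<in> G" "c \<in> G" for a c
  proof -
    obtain g h where gh: "g \<in> F" "h \<in> F" "(g \<^bold>\<and> b) \<^bold>\<and> a = g \<^bold>\<and> b" "(h \<^bold>\<and> b) \<^bold>\<and> c = h \<^bold>\<and> b"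
      "a \<in> carrier A" "c \<in> carrier A"
      using ac by (auto simp: G_def)
    then have car: "g \<in> carrier A" "h \<in> carrier A" using Fc by auto
    have "(g \<^bold>\<and> b) \<^bold>\<and> (h \<^bold>\<and> b) = (g \<^bold>\<and> h) \<^bold>\<and> b"
      using car b by (smt (verit, best) meet_assoc meet_closed meet_comm meet_idem)
    moreover have "((g \<^bold>\<and> b) \<^bold>\<and> (h \<^bold>\<and> b)) \<^bold>\<and> (a \<^bold>\<and> c) = (g \<^bold>\<and> b) \<^bold>\<and> (h \<^bold>\<and> b)"
      using gh car b by (simp add: meet_mono meet_closed)
    ultimately show ?thesis
      using gh Fm by (auto simp: G_def intro!: meet_closed bexI[of _ "g \<^bold>\<and> h"])
  qed
  show "ba_filter A G"
    unfolding ba_filter_def using \<open>F \<subseteq> G\<close> F1 up meet by (auto simp: G_def)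
qed

text \<open>Zorn's lemma gives a filter \<open>M\<close> maximal among those that contain
  \<open>F\<close> and avoid \<open>a\<close>. If it missed both \<open>b\<close> and its
  complement, adding either one would put \<open>a\<close> into the extension, and the case split on
  \<open>b\<close> would put \<open>a\<close> into \<open>M\<close>.\<close>

lemma ultrafilter_separation:
  assumes F: "ba_filter A F" and a: "a \<in> carrier A" "a \<notin> F"
  shows "\<exists>y. ultrafilter A y \<and> F \<subseteq> y \<and> a \<notin> y"
proof -
  let ?\<F> = "{G. ba_filter A G \<and> F \<subseteq> G \<and> a \<notin> G}"
  have "\<exists>M\<in>?\<F>. \<forall>X\<in>?\<F>. M \<subseteq> X \<longrightarrow> X = M"
  proof (rule subset_Zorn_nonempty)
    show "?\<F> \<noteq> {}" using assms by blast
    fix C assume C: "C \<noteq> {}" "subset.chain ?\<F> C"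
    then have sub: "C \<subseteq> ?\<F>" by (simp add: subset.chain_def)
    have up: "c \<in> \<Union>C" if bc: "b \<in> \<Union>C" "c \<in> carrier A" "b \<^bold>\<and> c = b" for b c
    proof -
      obtain G where "G \<in> C" "b \<in> G" using bc(1) by blast
      moreover have "ba_filter A G" using sub \<open>G \<in> C\<close> by blast
      ultimately have "c \<in> G" using bc(2,3) by (simp add: ba_filter_def)
      then show ?thesis using \<open>G \<in> C\<close> by blast
    qed
    have meet: "b \<^bold>\<and> c \<in> \<Union>C" if bc: "b \<in> \<Union>C" "c \<in> \<Union>C" for b c
    proof -
      obtain G H where GH: "b \<in> G" "c \<in> H" "G \<in> C" "H \<in> C" using bc by blast
      then have "G \<subseteq> H \<or> H \<subseteq> G" using C(2) by (simp add: subset.chain_def subset_chain_def) blast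
      then obtain K where "K \<in> C" "b \<in> K" "c \<in> K" using GH by blast
      moreover have "ba_filter A K" using sub \<open>K \<in> C\<close> by blast
      ultimately have "b \<^bold>\<and> c \<in> K" by (simp add: ba_filter_def)
      then show ?thesis using \<open>K \<in> C\<close> by blast
    qed
    have "G \<subseteq> carrier A \<and> \<^bold>1 \<in> G" if "G \<in> C" for G
      using that sub by (auto simp: ba_filter_def)
    then have "\<Union>C \<subseteq> carrier A" "\<^bold>1 \<in> \<Union>C" using C(1) by blast+
    then have "ba_filter A (\<Union>C)"
      unfolding ba_filter_def ba_order_simps using up meet by blast
    then show "\<Union>C \<in> ?\<F>" using sub C(1) by blast
  qed
  then obtain M where "M \<in> ?\<F>" and max': "\<forall>X\<in>?\<F>. M \<subseteq> X \<longrightarrow> X = M"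
    by blast
  then have M: "ba_filter A M" "F \<subseteq> M" "a \<notin> M" by auto
  have max: "X = M" if "ba_filter A X" "M \<subseteq> X" "a \<notin> X" for X
    using max' that M(2) by blast
  have Mc: "\<And>g. g \<in> M \<Longrightarrow> g \<in> carrier A" and Mm: "\<And>g h. g \<in> M \<Longrightarrow> h \<in> M \<Longrightarrow> g \<^bold>\<and> h \<in> M"
    and Mup: "\<And>g h. g \<in> M \<Longrightarrow> h \<in> carrier A \<Longrightarrow> g \<^bold>\<and> h = g \<Longrightarrow> h \<in> M"
    using M(1) by (auto simp: ba_filter_def)
  \<comment> \<open>The filter generated by \<open>M\<close> and \<open>b\<close> is strictly larger
    than \<open>M\<close>, so by maximality it must contain \<open>a\<close>.\<close>
  have ext: "\<exists>g\<in>M. (g \<^bold>\<and> b) \<^bold>\<and> a = g \<^bold>\<and> b" if "b \<in> carrier A" "b \<notin> M" for b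
    using ba_filter_extend[OF M(1) that(1)] max that(2) by blast
  have "b \<in> M \<or> \<^bold>- b \<in> M" if b: "b \<in> carrier A" for b
  proof (rule ccontr)
    assume "\<not> ?thesis"
    then obtain g h where gh: "g \<in> M" "h \<in> M"
      "(g \<^bold>\<and> b) \<^bold>\<and> a = g \<^bold>\<and> b" "(h \<^bold>\<and> \<^bold>- b) \<^bold>\<and> a = h \<^bold>\<and> \<^bold>- b"
      using ext[OF b] ext[OF compl_closed[OF b]] by blast
    note car = Mc[OF gh(1)] Mc[OF gh(2)] b a(1) compl_closed[OF b]
    have "(g \<^bold>\<and> h \<^bold>\<and> b) \<^bold>\<and> (g \<^bold>\<and> b) = g \<^bold>\<and> h \<^bold>\<and> b" "(g \<^bold>\<and> h \<^bold>\<and> \<^bold>- b) \<^bold>\<and> (h \<^bold>\<and> \<^bold>- b) = g \<^bold>\<and> h \<^bold>\<and> \<^bold>- b"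
      using car by (simp_all add: meet_mono meet_lower meet_idem meet_closed)
    then have "(g \<^bold>\<and> h \<^bold>\<and> b) \<^bold>\<and> a = g \<^bold>\<and> h \<^bold>\<and> b" "(g \<^bold>\<and> h \<^bold>\<and> \<^bold>- b) \<^bold>\<and> a = g \<^bold>\<and> h \<^bold>\<and> \<^bold>- b"
      using car gh(3,4) meet_le_trans[of "g \<^bold>\<and> h \<^bold>\<and> b" "g \<^bold>\<and> b" a]
        meet_le_trans[of "g \<^bold>\<and> h \<^bold>\<and> \<^bold>- b" "h \<^bold>\<and> \<^bold>- b" a] by (simp_all add: meet_closed)
    then have "g \<^bold>\<and> h \<^bold>\<and> a = g \<^bold>\<and> h"
      using car le_by_cases[of a b "g \<^bold>\<and> h"] by (simp add: meet_closed)
    then show False using Mup[OF Mm[OF gh(1,2)] a(1)] M(3) by blast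
  qed
  \<comment> \<open>Zero lies below \<open>a\<close>, so avoiding \<open>a\<close> already makes
    \<open>M\<close> proper.\<close>
  moreover have "\<^bold>0 \<notin> M" using Mup[of "\<^bold>0" a] a(1) M(3) meet_zero by blast
  ultimately show ?thesis
    using M by (intro exI[of _ M]) (auto simp: ultrafilter_def ba_filter_def)
qed

section \<open>Ultrafilters as two-valued valuations\<close>

lemma ultrafilter_mono:
  "\<lbrakk>ultrafilter A x; a \<in> x; b \<in> carrier A; a \<^bold>\<and> b = a\<rbrakk> \<Longrightarrow> b \<in> x"
  by (auto simp: ultrafilter_def)

lemma ultrafilter_meet:
  assumes "ultrafilter A x" "a \<in> carrier A" "b \<in> carrier A"
  shows "a \<^bold>\<and> b \<in> x \<longleftrightarrow> a \<in> x \<and> b \<in> x"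
proof
  assume "a \<^bold>\<and> b \<in> x"
  then show "a \<in> x \<and> b \<in> x"
    using ultrafilter_mono[OF assms(1)] meet_lower[OF assms(2,3)] assms(2,3) by blast
qed (use assms(1) in \<open>simp add: ultrafilter_def\<close>)

lemma ultrafilter_compl:
  assumes "ultrafilter A x" "a \<in> carrier A"
  shows "\<^bold>- a \<in> x \<longleftrightarrow> a \<notin> x"
proof -
  have "\<^bold>0 \<notin> x" "a \<in> x \<or> \<^bold>- a \<in> x" using assms by (simp_all add: ultrafilter_def)
  then show ?thesis
    using ultrafilter_meet[OF assms compl_closed[OF assms(2)]] meet_compl[OF assms(2)] by auto
qed

lemma ultrafilter_join:
  assumes "ultrafilter A x" "a \<in> carrier A" "b \<in> carrier A"
  shows "a \<^bold>\<or> b \<in> x \<longleftrightarrow> a \<in> x \<or> b \<in> x"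
proof
  assume "a \<in> x \<or> b \<in> x"
  moreover have "a \<^bold>\<and> (a \<^bold>\<or> b) = a" "b \<^bold>\<and> (a \<^bold>\<or> b) = b"
    using assms(2,3) meet_join_absorb[of a b] meet_join_absorb[of b a] join_comm[of a b] by simp_all
  ultimately show "a \<^bold>\<or> b \<in> x"
    using ultrafilter_mono[OF assms(1) _ join_closed[OF assms(2,3)]] by blast
next
  assume "a \<^bold>\<or> b \<in> x"
  show "a \<in> x \<or> b \<in> x"
  proof (cases "a \<in> x")
    case False
    then have "\<^bold>- a \<^bold>\<and> (a \<^bold>\<or> b) \<in> x"
      using assms \<open>a \<^bold>\<or> b \<in> x\<close> by (simp add: ultrafilter_meet ultrafilter_compl compl_closed join_closed)
    moreover have "\<^bold>- a \<^bold>\<and> (a \<^bold>\<or> b) = \<^bold>- a \<^bold>\<and> b"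
      using assms(2,3) by (metis compl_closed join_comm join_zero meet_closed meet_comm meet_compl
          meet_join_distrib zero_closed)
    ultimately show ?thesis using assms by (simp add: ultrafilter_meet compl_closed)
  qed simp
qed

text \<open>If \<open>b\<close> is not in the principal filter of \<open>a\<close>, some ultrafilter
  contains \<open>a\<close> but not \<open>b\<close>. Boolean identities can then be checked by
  propositional reasoning about membership, which replaces most equational calculation
  below.\<close>

lemma le_iff_ultrafilters:
  assumes "a \<in> carrier A" "b \<in> carrier A"
  shows "a \<^bold>\<and> b = a \<longleftrightarrow> (\<forall>x. ultrafilter A x \<longrightarrow> a \<in> x \<longrightarrow> b \<in> x)"
proof
  assume "\<forall>x. ultrafilter A x \<longrightarrow> a \<in> x \<longrightarrow> b \<in> x"
  moreover have "ba_filter A {c \<in> carrier A. a \<^bold>\<and> c = a}"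
    unfolding ba_filter_def
  proof (intro conjI ballI impI)
    show "\<^bold>1 \<in> {c \<in> carrier A. a \<^bold>\<and> c = a}" using assms one_closed meet_one by simp
    show "d \<in> {c \<in> carrier A. a \<^bold>\<and> c = a}"
      if "c \<in> {c \<in> carrier A. a \<^bold>\<and> c = a}" "d \<in> carrier A" "c \<^bold>\<le> d" for c d
      using that meet_le_trans[OF assms(1), of c d] by simp
    show "c \<^bold>\<and> d \<in> {c \<in> carrier A. a \<^bold>\<and> c = a}"
      if "c \<in> {c \<in> carrier A. a \<^bold>\<and> c = a}" "d \<in> {c \<in> carrier A. a \<^bold>\<and> c = a}" for c d
      using that meet_assoc[OF assms(1), of c d] meet_closed[of c d] by simp
  qed blast
  ultimately show "a \<^bold>\<and> b = a"
    using ultrafilter_separation[of "{c \<in> carrier A. a \<^bold>\<and> c = a}" b] assms meet_idem by blast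
next
  assume "a \<^bold>\<and> b = a"
  then show "\<forall>x. ultrafilter A x \<longrightarrow> a \<in> x \<longrightarrow> b \<in> x"
    using ultrafilter_mono[OF _ _ assms(2)] by blast
qed

lemma eq_iff_ultrafilters:
  assumes "a \<in> carrier A" "b \<in> carrier A"
  shows "a = b \<longleftrightarrow> (\<forall>x. ultrafilter A x \<longrightarrow> (a \<in> x \<longleftrightarrow> b \<in> x))"
  using le_iff_ultrafilters[OF assms] le_iff_ultrafilters[OF assms(2,1)] meet_comm[OF assms] by metis

lemmas ultrafilter_simps = ultrafilter_meet ultrafilter_compl ultrafilter_join
  meet_closed join_closed compl_closed zero_closed one_closed

lemma compl_compl: "a \<in> carrier A \<Longrightarrow> \<^bold>- (\<^bold>- a) = a"
  by (subst eq_iff_ultrafilters) (auto simp: ultrafilter_simps)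

lemma ultrafilter_one_zero: "ultrafilter A x \<Longrightarrow> \<^bold>1 \<in> x" "ultrafilter A x \<Longrightarrow> \<^bold>0 \<notin> x"
  by (auto simp: ultrafilter_def)

section \<open>Finite meets and their preservation by homomorphisms\<close>

lemma finite_Meet_glb:
  assumes "finite T" "T \<noteq> {}" "T \<subseteq> carrier A"
  shows "\<^bold>\<And> T \<in> carrier A" "is_glb (ba_order A) (\<^bold>\<And> T) T"
  using finite_Meet_in[of "carrier A" T] assms meet_closed by blast+

lemma le_finite_Meet_iff:
  assumes "finite T" "T \<noteq> {}" "T \<subseteq> carrier A" "a \<in> carrier A"
  shows "a \<^bold>\<and> \<^bold>\<And> T = a \<longleftrightarrow> (\<forall>t\<in>T. a \<^bold>\<and> t = a)"
proof -
  have glb: "\<^bold>\<And> T \<in> carrier A" "\<forall>t\<in>T. \<^bold>\<And> T \<^bold>\<and> t = \<^bold>\<And> T"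
    "\<forall>l\<in>carrier A. (\<forall>t\<in>T. l \<^bold>\<and> t = l) \<longrightarrow> l \<^bold>\<and> \<^bold>\<And> T = l"
    using finite_Meet_glb(2)[OF assms(1-3)] unfolding is_glb_iff[OF assms(3)] by blast+
  have "a \<^bold>\<and> t = a" if "a \<^bold>\<and> \<^bold>\<And> T = a" "t \<in> T" for t
    using meet_le_trans[OF assms(4) glb(1) subsetD[OF assms(3) that(2)]] that glb(2) by blast
  then show ?thesis using glb(3) assms(4) by blast
qed

lemma Meet_singleton: "a \<in> carrier A \<Longrightarrow> \<^bold>\<And> {a} = a"
  by (intro Meet_eqI) (auto simp: is_glb_iff meet_idem)

lemma Meet_insert:
  assumes "finite T" "T \<noteq> {}" "T \<subseteq> carrier A" "a \<in> carrier A"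
  shows "\<^bold>\<And> (insert a T) = a \<^bold>\<and> \<^bold>\<And> T"
proof (rule Meet_eqI, subst is_glb_iff)
  note T = finite_Meet_glb(1)[OF assms(1-3)]
  have "\<^bold>\<And> T \<^bold>\<and> t = \<^bold>\<And> T" if "t \<in> T" for t
    using le_finite_Meet_iff[OF assms(1-3) T] that T meet_idem by blast
  then have "(a \<^bold>\<and> \<^bold>\<And> T) \<^bold>\<and> t = a \<^bold>\<and> \<^bold>\<And> T" if "t \<in> T" for t
    using that T assms meet_assoc[of a "\<^bold>\<And> T" t] by auto
  moreover have "l \<^bold>\<and> (a \<^bold>\<and> \<^bold>\<And> T) = l"
    if "l \<in> carrier A" "\<forall>t\<in>insert a T. l \<^bold>\<and> t = l" for l
    using that T assms meet_assoc[of l a "\<^bold>\<And> T"] le_finite_Meet_iff[OF assms(1-3) that(1)] by auto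
  ultimately show "a \<^bold>\<and> \<^bold>\<And> T \<in> carrier A \<and> (\<forall>t\<in>insert a T. a \<^bold>\<and> \<^bold>\<And> T \<^bold>\<and> t = a \<^bold>\<and> \<^bold>\<And> T) \<and>
      (\<forall>l\<in>carrier A. (\<forall>t\<in>insert a T. l \<^bold>\<and> t = l) \<longrightarrow> l \<^bold>\<and> (a \<^bold>\<and> \<^bold>\<And> T) = l)"
    using T assms meet_lower meet_closed by auto
qed (use assms in auto)

end

lemma ba_hom_Meet:
  assumes "boolean_alg A" "boolean_alg B" "ba_hom A B f" "finite T" "T \<noteq> {}" "T \<subseteq> carrier A"
  shows "f (\<^bold>\<And>\<^bsub>A\<^esub> T) = \<^bold>\<And>\<^bsub>B\<^esub> (f ` T)"
  using assms(4-6)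
proof (induction rule: finite_ne_induct)
  case (singleton x)
  then have "x \<in> carrier A" "f x \<in> carrier B" using assms(3) by (auto simp: ba_hom_def)
  then show ?case
    by (simp add: boolean_alg.Meet_singleton[OF assms(1)] boolean_alg.Meet_singleton[OF assms(2)])
next
  case (insert x T)
  have "\<^bold>\<And>\<^bsub>A\<^esub> T \<in> carrier A"
    using insert boolean_alg.finite_Meet_glb(1)[OF assms(1)] by blast
  moreover have "f ` T \<subseteq> carrier B" "f x \<in> carrier B"
    using insert.prems assms(3) by (auto simp: ba_hom_def)
  ultimately show ?case
    using insert assms(3) by (simp add: boolean_alg.Meet_insert[OF assms(1)]
        boolean_alg.Meet_insert[OF assms(2)] ba_hom_def)
qed

section \<open>Interior and closure\<close>

context tangled_closure_algebra
begin

lemma cl_closed: "a \<in> carrier A \<Longrightarrow> \<^bold>C a \<in> carrier A"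
  by (simp add: cl_def tangle_closed fin_subset_def)

lemma itr_eq: "\<^bold>I a = \<^bold>- \<^bold>C (\<^bold>- a)"
  by (simp add: itr_def cl_def)

lemma itr_closed: "a \<in> carrier A \<Longrightarrow> \<^bold>I a \<in> carrier A"
  by (simp add: itr_eq cl_closed compl_closed)

lemma cl_mono:
  assumes "a \<in> carrier A" "b \<in> carrier A" "a \<^bold>\<and> b = a"
  shows "\<^bold>C a \<^bold>\<and> \<^bold>C b = \<^bold>C a"
proof -
  have "b = a \<^bold>\<or> b"
    using assms by (metis join_comm join_meet_absorb meet_comm)
  then have "\<^bold>C b = \<^bold>C a \<^bold>\<or> \<^bold>C b" using cl_join[OF assms(1,2)] by simp
  then show ?thesis using assms by (metis cl_closed meet_join_absorb)
qed

lemma itr_one: "\<^bold>I \<^bold>1 = \<^bold>1"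
proof -
  have "\<^bold>- \<^bold>1 = \<^bold>0" "\<^bold>- \<^bold>0 = \<^bold>1"
    by (subst eq_iff_ultrafilters; auto simp: ultrafilter_simps ultrafilter_one_zero)+
  then show ?thesis by (simp add: itr_eq cl_zero)
qed

lemma itr_meet:
  assumes "a \<in> carrier A" "b \<in> carrier A"
  shows "\<^bold>I (a \<^bold>\<and> b) = \<^bold>I a \<^bold>\<and> \<^bold>I b"
proof -
  have de_morgan: "\<^bold>- (c \<^bold>\<and> d) = \<^bold>- c \<^bold>\<or> \<^bold>- d" "\<^bold>- (c \<^bold>\<or> d) = \<^bold>- c \<^bold>\<and> \<^bold>- d"
    if "c \<in> carrier A" "d \<in> carrier A" for c d
    using that by (subst eq_iff_ultrafilters; auto simp: ultrafilter_simps)+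
  show ?thesis using assms by (simp add: itr_eq de_morgan cl_join cl_closed compl_closed)
qed

lemma itr_idem: "a \<in> carrier A \<Longrightarrow> \<^bold>I (\<^bold>I a) = \<^bold>I a"
  by (simp add: itr_eq compl_compl cl_idem cl_closed compl_closed)

lemma itr_decreasing:
  assumes "a \<in> carrier A" "ultrafilter A x" "\<^bold>I a \<in> x"
  shows "a \<in> x"
  using assms cl_increasing[of "\<^bold>- a"] ultrafilter_mono[of x "\<^bold>- a" "\<^bold>C (\<^bold>- a)"]
  by (auto simp: itr_eq ultrafilter_simps cl_closed)

text \<open>Always \<open>a\<close> lies below the join of \<open>b\<close> and the complement of a
  \<Rightarrow> b. Applying the additive closure gives two disjuncts, and the second is the
  complement of I(a \<Rightarrow> b), hence outside \<open>x\<close>.\<close>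

lemma itr_imp_cl:
  assumes "a \<in> carrier A" "b \<in> carrier A" "ultrafilter A x" "\<^bold>I (a \<^bold>\<Rightarrow> b) \<in> x" "\<^bold>C a \<in> x"
  shows "\<^bold>C b \<in> x"
proof -
  have "a \<^bold>\<and> (b \<^bold>\<or> \<^bold>- (a \<^bold>\<Rightarrow> b)) = a"
    using assms by (subst le_iff_ultrafilters) (auto simp: ultrafilter_simps)
  then have "\<^bold>C (b \<^bold>\<or> \<^bold>- (a \<^bold>\<Rightarrow> b)) \<in> x"
    using assms cl_mono[of a "b \<^bold>\<or> \<^bold>- (a \<^bold>\<Rightarrow> b)"] ultrafilter_mono[of x "\<^bold>C a"]
    by (simp add: cl_closed ultrafilter_simps)
  then show ?thesis
    using assms by (simp add: cl_join itr_eq ultrafilter_simps cl_closed)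
qed

section \<open>The algebra of sets of ultrafilters\<close>

text \<open>The ultrafilters extending this filter are exactly the successors of \<open>x\<close>,
  so separation applied to it produces points of U.\<close>

lemma ba_filter_itr:
  assumes "ultrafilter A x"
  shows "ba_filter A {a \<in> carrier A. \<^bold>I a \<in> x}"
proof -
  have "\<^bold>I b \<in> x" if "a \<in> carrier A" "b \<in> carrier A" "\<^bold>I a \<in> x" "a \<^bold>\<and> b = a" for a b
    using that itr_meet[of a b] assms ultrafilter_mono[of x "\<^bold>I a" "\<^bold>I b"] itr_closed by simp
  then show ?thesis
    using assms by (auto simp: ba_filter_def one_closed itr_one ultrafilter_one_zero meet_closed
        itr_meet ultrafilter_meet itr_closed)
qed

text \<open>The dictionary between U and the algebra. If I(a \<Rightarrow> b) is not in
  \<open>x\<close>, then a \<Rightarrow> b is outside the filter of all \<open>c\<close> with Ic in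
  \<open>x\<close>, and a separating ultrafilter is a successor of \<open>x\<close> containing
  \<open>a\<close> but not \<open>b\<close>. The converse is the definition of the relation.\<close>

lemma bracket_subset_iff:
  assumes "ultrafilter A x" "a \<in> carrier A" "b \<in> carrier A"
  shows "bracket A x a \<subseteq> bracket A x b \<longleftrightarrow> \<^bold>I (a \<^bold>\<Rightarrow> b) \<in> x"
proof
  assume sub: "bracket A x a \<subseteq> bracket A x b"
  show "\<^bold>I (a \<^bold>\<Rightarrow> b) \<in> x"
  proof (rule ccontr)
    assume "\<not> ?thesis"
    then obtain y where "ultrafilter A y" "{c \<in> carrier A. \<^bold>I c \<in> x} \<subseteq> y" "a \<^bold>\<Rightarrow> b \<notin> y"
      using ultrafilter_separation[OF ba_filter_itr[OF assms(1)], of "a \<^bold>\<Rightarrow> b"] assms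
      by (auto simp: ultrafilter_simps)
    then show False
      using sub assms
      by (auto simp: bracket_def successors_def canonical_rel_def ultrafilter_simps)
  qed
next
  assume "\<^bold>I (a \<^bold>\<Rightarrow> b) \<in> x"
  moreover have "a \<^bold>\<Rightarrow> b \<in> carrier A" using assms by (simp add: ultrafilter_simps)
  ultimately have "a \<^bold>\<Rightarrow> b \<in> y" if "y \<in> successors A x" for y
    using that by (auto simp: successors_def canonical_rel_def)
  then show "bracket A x a \<subseteq> bracket A x b"
    using assms by (auto simp: bracket_def successors_def ultrafilter_simps)
qed

text \<open>Idempotence of the interior, that is, transitivity of the frame: I(Ia) = Ia is in
  \<open>x\<close>, so Ia passes to \<open>y\<close>.\<close>

lemma itr_successor:
  assumes "ultrafilter A x" "a \<in> carrier A" "\<^bold>I a \<in> x" "y \<in> successors A x"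
  shows "\<^bold>I a \<in> y"
  using assms itr_idem[of a] itr_closed by (auto simp: successors_def canonical_rel_def)

text \<open>Reflexivity of the canonical relation. It makes \<open>x\<close> itself a point of U,
  where the final contradiction is read off.\<close>

lemma self_successor: "ultrafilter A x \<Longrightarrow> x \<in> successors A x"
  using itr_decreasing by (auto simp: successors_def canonical_rel_def)

text \<open>The inclusion is witnessed by I(a \<Rightarrow> b) in \<open>x\<close>, which persists
  to every successor and there turns Ca into Cb.\<close>

lemma bracket_cl_mono:
  assumes "ultrafilter A x" "a \<in> carrier A" "b \<in> carrier A" "bracket A x a \<subseteq> bracket A x b"
  shows "bracket A x (\<^bold>C a) \<subseteq> bracket A x (\<^bold>C b)"
proof -
  have "\<^bold>I (a \<^bold>\<Rightarrow> b) \<in> x" using assms bracket_subset_iff by blast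
  then have "\<^bold>I (a \<^bold>\<Rightarrow> b) \<in> y" if "y \<in> successors A x" for y
    using that assms itr_successor[of x "a \<^bold>\<Rightarrow> b"] by (simp add: ultrafilter_simps)
  then show ?thesis using itr_imp_cl[OF assms(2,3)] by (auto simp: bracket_def successors_def)
qed

lemma bracket_meet:
  "\<lbrakk>a \<in> carrier A; b \<in> carrier A\<rbrakk> \<Longrightarrow> bracket A x (a \<^bold>\<and> b) = bracket A x a \<inter> bracket A x b"
  by (auto simp: bracket_def successors_def ultrafilter_simps)

section \<open>The tangle on brackets is well defined\<close>

lemma tangle_le:
  assumes "fin_subset A \<Gamma>" "\<gamma> \<in> \<Gamma>"
  shows "\<^bold>C\<^sup>t \<Gamma> \<^bold>\<and> \<^bold>C (\<gamma> \<^bold>\<and> \<^bold>C\<^sup>t \<Gamma>) = \<^bold>C\<^sup>t \<Gamma>"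
proof -
  note t = tangle_closed[OF assms(1)]
  have "(\<lambda>\<gamma>. \<^bold>C (\<gamma> \<^bold>\<and> \<^bold>C\<^sup>t \<Gamma>)) ` \<Gamma> \<subseteq> carrier A"
    using assms(1) t by (auto simp: fin_subset_def intro!: cl_closed meet_closed)
  then show ?thesis
    using Fix[OF assms(1)] assms le_finite_Meet_iff[OF _ _ _ t, of "(\<lambda>\<gamma>. \<^bold>C (\<gamma> \<^bold>\<and> \<^bold>C\<^sup>t \<Gamma>)) ` \<Gamma>"]
    by (auto simp: fin_subset_def)
qed

text \<open>On U the tangle of \<Gamma> is a post-fixed point for \<Delta>: Fix for \<Gamma> places
  it below each C(\<gamma> \<and> C\<open>\<^sup>t\<close>\<Gamma>), and a suitable \<gamma> is
  dominated by the given \<delta>. Ind for \<Delta> then applies. Asking only for domination covers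
  families of different sizes with the same brackets.\<close>

lemma bracket_tangle_mono:
  assumes x: "ultrafilter A x" and fin: "fin_subset A \<Gamma>" "fin_subset A \<Delta>"
    and sub: "\<And>\<delta>. \<delta> \<in> \<Delta> \<Longrightarrow> \<exists>\<gamma>\<in>\<Gamma>. bracket A x \<gamma> \<subseteq> bracket A x \<delta>"
  shows "bracket A x (\<^bold>C\<^sup>t \<Gamma>) \<subseteq> bracket A x (\<^bold>C\<^sup>t \<Delta>)"
proof -
  let ?a = "\<^bold>C\<^sup>t \<Gamma>" and ?T = "(\<lambda>\<delta>. \<^bold>C (\<delta> \<^bold>\<and> \<^bold>C\<^sup>t \<Gamma>)) ` \<Delta>"
  have a: "?a \<in> carrier A" "\<^bold>C\<^sup>t \<Delta> \<in> carrier A" using fin tangle_closed by auto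
  have T: "finite ?T" "?T \<noteq> {}" "?T \<subseteq> carrier A"
    using fin(2) a by (auto simp: fin_subset_def intro!: cl_closed meet_closed)
  have le: "bracket A x ?a \<subseteq> bracket A x (\<^bold>C (\<delta> \<^bold>\<and> ?a))" if \<delta>: "\<delta> \<in> \<Delta>" for \<delta>
  proof -
    obtain \<gamma> where \<gamma>: "\<gamma> \<in> \<Gamma>" "bracket A x \<gamma> \<subseteq> bracket A x \<delta>" using sub \<delta> by blast
    have car: "\<gamma> \<in> carrier A" "\<delta> \<in> carrier A" using \<gamma>(1) \<delta> fin by (auto simp: fin_subset_def)
    have "bracket A x ?a \<subseteq> bracket A x (\<^bold>C (\<gamma> \<^bold>\<and> ?a))"
      using tangle_le[OF fin(1) \<gamma>(1)] bracket_meet[OF a(1), of "\<^bold>C (\<gamma> \<^bold>\<and> ?a)" x] car a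
      by (auto simp: cl_closed meet_closed)
    also have "\<dots> \<subseteq> bracket A x (\<^bold>C (\<delta> \<^bold>\<and> ?a))"
      using \<gamma>(2) car a x by (intro bracket_cl_mono) (auto simp: bracket_meet meet_closed)
    finally show ?thesis .
  qed
  have Meet: "\<^bold>\<And> S \<in> y \<longleftrightarrow> S \<subseteq> y" if "ultrafilter A y" "finite S" "S \<noteq> {}" "S \<subseteq> carrier A" for S y
    using that(2-)
    by (induction rule: finite_ne_induct)
      (auto simp: Meet_singleton Meet_insert ultrafilter_meet[OF that(1)] finite_Meet_glb(1))
  have "bracket A x ?a \<subseteq> bracket A x (\<^bold>\<And> ?T)"
  proof
    fix y assume y: "y \<in> bracket A x ?a"
    then have "y \<in> successors A x" "ultrafilter A y" by (auto simp: bracket_def successors_def)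
    moreover have "?T \<subseteq> y" using le y by (auto simp: bracket_def)
    ultimately show "y \<in> bracket A x (\<^bold>\<And> ?T)" using Meet[OF _ T] by (simp add: bracket_def)
  qed
  \<comment> \<open>The inclusion over all of U becomes a single membership in \<open>x\<close>,
    which can be moved to any successor \<open>y\<close>, where Ind is applied.\<close>
  then have I: "\<^bold>I (?a \<^bold>\<Rightarrow> \<^bold>\<And> ?T) \<in> x"
    using bracket_subset_iff[OF x a(1) finite_Meet_glb(1)[OF T]] by blast
  show ?thesis
  proof
    fix y assume y: "y \<in> bracket A x ?a"
    then have "\<^bold>I (?a \<^bold>\<Rightarrow> \<^bold>\<And> ?T) \<^bold>\<and> ?a \<in> y"
      using itr_successor[OF x _ I, of y] a finite_Meet_glb(1)[OF T]
      by (auto simp: bracket_def successors_def ultrafilter_simps itr_closed)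
    then show "y \<in> bracket A x (\<^bold>C\<^sup>t \<Delta>)"
      using Ind[OF fin(2) a(1)] y a ultrafilter_mono[of y _ "\<^bold>C\<^sup>t \<Delta>"]
      by (auto simp: bracket_def successors_def)
  qed
qed

text \<open>Families with the same set of brackets dominate each other in both directions, so the
  definite description has exactly one candidate.\<close>

lemma bracket_alg_tangle:
  assumes x: "ultrafilter A x" and \<Gamma>: "fin_subset A \<Gamma>"
  shows "\<^bold>C\<^sup>t\<^bsub>bracket_alg A x\<^esub> (bracket A x ` \<Gamma>) = bracket A x (\<^bold>C\<^sup>t \<Gamma>)"
proof -
  have "bracket A x (\<^bold>C\<^sup>t \<Delta>) \<subseteq> bracket A x (\<^bold>C\<^sup>t \<Delta>')"
    if "fin_subset A \<Delta>" "fin_subset A \<Delta>'" "bracket A x ` \<Delta> = bracket A x ` \<Delta>'" for \<Delta> \<Delta>'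
    using that(3) by (intro bracket_tangle_mono[OF x that(1,2)]) (metis image_iff order_refl)
  then have "X = bracket A x (\<^bold>C\<^sup>t \<Gamma>)"
    if "\<exists>\<Delta>. fin_subset A \<Delta> \<and> bracket A x ` \<Gamma> = bracket A x ` \<Delta> \<and> X = bracket A x (\<^bold>C\<^sup>t \<Delta>)" for X
    using that \<Gamma> by (metis subset_antisym)
  then show ?thesis
    using \<Gamma> by (auto simp: bracket_alg_def intro!: the_equality)
qed

lemma bracket_hom:
  assumes "ultrafilter A x"
  shows "tca_hom A (bracket_alg A x) (bracket A x)"
  unfolding tca_hom_def ba_hom_def
  using assms bracket_alg_tangle[OF assms]
  by (auto simp: bracket_alg_def bracket_def successors_def ultrafilter_simps ultrafilter_one_zero)

lemma boolean_alg_bracket_alg: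
  assumes "ultrafilter A x"
  shows "boolean_alg (bracket_alg A x)"
proof -
  note h = bracket_hom[OF assms, unfolded tca_hom_def ba_hom_def]
  have car: "carrier (bracket_alg A x) = bracket A x ` carrier A"
    by (simp add: bracket_alg_def)
  \<comment> \<open>Complements are relative to U, so the unit and complement laws rest on every
    element being a subset of U.\<close>
  have "\<forall>a\<in>carrier (bracket_alg A x). a \<subseteq> successors A x"
    by (auto simp: bracket_alg_def bracket_def)
  moreover have "a \<^bold>\<and>\<^bsub>bracket_alg A x\<^esub> b \<in> carrier (bracket_alg A x)"
    "a \<^bold>\<or>\<^bsub>bracket_alg A x\<^esub> b \<in> carrier (bracket_alg A x)"
    "\<^bold>-\<^bsub>bracket_alg A x\<^esub> a \<in> carrier (bracket_alg A x)"
    if "a \<in> carrier (bracket_alg A x)" "b \<in> carrier (bracket_alg A x)" for a b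
    using that h unfolding car by (auto simp: image_iff Bex_def; metis ultrafilter_simps(4-6))+
  moreover have "\<^bold>0\<^bsub>bracket_alg A x\<^esub> \<in> carrier (bracket_alg A x)"
    "\<^bold>1\<^bsub>bracket_alg A x\<^esub> \<in> carrier (bracket_alg A x)"
    using h zero_closed one_closed unfolding car by (metis image_eqI)+
  ultimately show ?thesis
    by unfold_locales (auto simp: bracket_alg_def)
qed

end

section \<open>Homomorphisms and homomorphic images\<close>

lemma tca_hom_cl_itr:
  assumes "tangled_closure_algebra A" "tca_hom A B f" "a \<in> carrier A"
  shows "f (\<^bold>C\<^bsub>A\<^esub> a) = \<^bold>C\<^bsub>B\<^esub> (f a)" "f (\<^bold>I\<^bsub>A\<^esub> a) = \<^bold>I\<^bsub>B\<^esub> (f a)"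
proof -
  interpret tangled_closure_algebra A by fact
  have cl: "f (\<^bold>C\<^bsub>A\<^esub> c) = \<^bold>C\<^bsub>B\<^esub> (f c)" if "c \<in> carrier A" for c
    using assms(2) that by (simp add: tca_hom_def cl_def fin_subset_def)
  then show "f (\<^bold>C\<^bsub>A\<^esub> a) = \<^bold>C\<^bsub>B\<^esub> (f a)" using assms(3) by blast
  have "f (\<^bold>I\<^bsub>A\<^esub> a) = \<^bold>-\<^bsub>B\<^esub> (f (\<^bold>C\<^bsub>A\<^esub> (\<^bold>-\<^bsub>A\<^esub> a)))"
    using assms(2,3) by (simp add: itr_eq tca_hom_def ba_hom_def cl_closed compl_closed)
  then show "f (\<^bold>I\<^bsub>A\<^esub> a) = \<^bold>I\<^bsub>B\<^esub> (f a)"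
    using assms(2,3) cl[OF compl_closed[OF assms(3)]]
    by (simp add: itr_def cl_def tca_hom_def ba_hom_def)
qed

text \<open>The axioms are equations and inequalities between terms that \<open>f\<close> preserves,
  so they hold at all values of \<open>f\<close>. With the bracket map as \<open>f\<close>, this
  makes the algebra of sets a tangled closure algebra.\<close>

lemma tca_hom_image:
  assumes A: "tangled_closure_algebra A" and B: "boolean_alg B"
    and f: "tca_hom A B f" and surj: "f ` carrier A = carrier B"
  shows "tangled_closure_algebra B"
proof -
  interpret A: tangled_closure_algebra A by fact
  interpret B: boolean_alg B by fact
  have bf: "ba_hom A B f" using f by (simp add: tca_hom_def)
  note h = bf[unfolded ba_hom_def]
  note ci = tca_hom_cl_itr[OF A f]
  have tan: "f (\<^bold>C\<^sup>t\<^bsub>A\<^esub> \<Gamma>) = \<^bold>C\<^sup>t\<^bsub>B\<^esub> (f ` \<Gamma>)" if "fin_subset A \<Gamma>" for \<Gamma>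
    using f that by (simp add: tca_hom_def)
  \<comment> \<open>Surjectivity lets a finite family in \<open>B\<close> be pulled back to a finite
    one in \<open>A\<close>, as the axioms of \<open>A\<close> require.\<close>
  have lift: "\<exists>\<Gamma>. fin_subset A \<Gamma> \<and> \<Delta> = f ` \<Gamma>" if "fin_subset B \<Delta>" for \<Delta>
    using that surj finite_subset_image[of \<Delta> f "carrier A"] by (auto simp: fin_subset_def)
  have Meet: "f (\<^bold>\<And>\<^bsub>A\<^esub> ((\<lambda>\<gamma>. \<^bold>C\<^bsub>A\<^esub> (\<gamma> \<^bold>\<and>\<^bsub>A\<^esub> a)) ` \<Gamma>)) = \<^bold>\<And>\<^bsub>B\<^esub> ((\<lambda>\<gamma>. \<^bold>C\<^bsub>B\<^esub> (\<gamma> \<^bold>\<and>\<^bsub>B\<^esub> f a)) ` f ` \<Gamma>)"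
    and Meet_car: "\<^bold>\<And>\<^bsub>A\<^esub> ((\<lambda>\<gamma>. \<^bold>C\<^bsub>A\<^esub> (\<gamma> \<^bold>\<and>\<^bsub>A\<^esub> a)) ` \<Gamma>) \<in> carrier A"
    if "fin_subset A \<Gamma>" "a \<in> carrier A" for \<Gamma> a
  proof -
    let ?T = "(\<lambda>\<gamma>. \<^bold>C\<^bsub>A\<^esub> (\<gamma> \<^bold>\<and>\<^bsub>A\<^esub> a)) ` \<Gamma>"
    have T: "finite ?T" "?T \<noteq> {}" "?T \<subseteq> carrier A"
      using that by (auto simp: fin_subset_def intro!: A.cl_closed A.meet_closed)
    show "\<^bold>\<And>\<^bsub>A\<^esub> ?T \<in> carrier A" by (rule A.finite_Meet_glb(1)[OF T])
    have "f ` ?T = (\<lambda>\<gamma>. \<^bold>C\<^bsub>B\<^esub> (\<gamma> \<^bold>\<and>\<^bsub>B\<^esub> f a)) ` f ` \<Gamma>"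
      unfolding image_image using that h
      by (intro image_cong refl) (auto simp: fin_subset_def subset_iff ci A.meet_closed)
    then show "f (\<^bold>\<And>\<^bsub>A\<^esub> ?T) = \<^bold>\<And>\<^bsub>B\<^esub> ((\<lambda>\<gamma>. \<^bold>C\<^bsub>B\<^esub> (\<gamma> \<^bold>\<and>\<^bsub>B\<^esub> f a)) ` f ` \<Gamma>)"
      using ba_hom_Meet[OF A.boolean_alg_axioms B bf T] by simp
  qed
  have le: "f a \<^bold>\<le>\<^bsub>B\<^esub> f b" if "a \<^bold>\<le>\<^bsub>A\<^esub> b" "a \<in> carrier A" "b \<in> carrier A" for a b
    using that h by (metis ba_order_simps(3))
  show ?thesis
  proof
    fix \<Delta> assume "fin_subset B \<Delta>"
    then obtain \<Gamma> where \<Gamma>: "fin_subset A \<Gamma>" "\<Delta> = f ` \<Gamma>" using lift by blast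
    note t = A.tangle_closed[OF \<Gamma>(1)]
    show "\<^bold>C\<^sup>t\<^bsub>B\<^esub> \<Delta> \<in> carrier B" using t tan[OF \<Gamma>(1)] \<Gamma>(2) surj by (metis image_eqI)
    show "\<^bold>C\<^sup>t\<^bsub>B\<^esub> \<Delta> \<^bold>\<le>\<^bsub>B\<^esub> \<^bold>\<And>\<^bsub>B\<^esub> ((\<lambda>\<gamma>. \<^bold>C\<^bsub>B\<^esub> (\<gamma> \<^bold>\<and>\<^bsub>B\<^esub> \<^bold>C\<^sup>t\<^bsub>B\<^esub> \<Delta>)) ` \<Delta>)"
      using le[OF A.Fix[OF \<Gamma>(1)] t Meet_car[OF \<Gamma>(1) t]]
      unfolding Meet[OF \<Gamma>(1) t] tan[OF \<Gamma>(1)] \<Gamma>(2) .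
    fix b assume "b \<in> carrier B"
    then obtain a where a: "a \<in> carrier A" "b = f a" using surj by blast
    let ?m = "\<^bold>\<And>\<^bsub>A\<^esub> ((\<lambda>\<gamma>. \<^bold>C\<^bsub>A\<^esub> (\<gamma> \<^bold>\<and>\<^bsub>A\<^esub> a)) ` \<Gamma>)"
    note m = Meet_car[OF \<Gamma>(1) a(1)]
    have im: "a \<^bold>\<Rightarrow>\<^bsub>A\<^esub> ?m \<in> carrier A" "\<^bold>I\<^bsub>A\<^esub> (a \<^bold>\<Rightarrow>\<^bsub>A\<^esub> ?m) \<in> carrier A"
      using m a by (auto intro!: A.itr_closed A.join_closed A.compl_closed)
    have "f (\<^bold>I\<^bsub>A\<^esub> (a \<^bold>\<Rightarrow>\<^bsub>A\<^esub> ?m) \<^bold>\<and>\<^bsub>A\<^esub> a) = \<^bold>I\<^bsub>B\<^esub> (f a \<^bold>\<Rightarrow>\<^bsub>B\<^esub> f ?m) \<^bold>\<and>\<^bsub>B\<^esub> f a"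
      using h im m a ci(2)[OF im(1)] A.compl_closed by simp
    then show "\<^bold>I\<^bsub>B\<^esub> (b \<^bold>\<Rightarrow>\<^bsub>B\<^esub> \<^bold>\<And>\<^bsub>B\<^esub> ((\<lambda>\<gamma>. \<^bold>C\<^bsub>B\<^esub> (\<gamma> \<^bold>\<and>\<^bsub>B\<^esub> b)) ` \<Delta>)) \<^bold>\<and>\<^bsub>B\<^esub> b \<^bold>\<le>\<^bsub>B\<^esub> \<^bold>C\<^sup>t\<^bsub>B\<^esub> \<Delta>"
      using le[OF A.Ind[OF \<Gamma>(1) a(1)] A.meet_closed[OF im(2) a(1)] t]
      unfolding Meet[OF \<Gamma>(1) a(1)] tan[OF \<Gamma>(1)] \<Gamma>(2) a(2) by simp
  next
    fix a b assume "a \<in> carrier B" "b \<in> carrier B"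
    then obtain c d where cd: "c \<in> carrier A" "d \<in> carrier A" "a = f c" "b = f d" using surj by blast
    then have "f (\<^bold>C\<^bsub>A\<^esub> (c \<^bold>\<or>\<^bsub>A\<^esub> d)) = f (\<^bold>C\<^bsub>A\<^esub> c \<^bold>\<or>\<^bsub>A\<^esub> \<^bold>C\<^bsub>A\<^esub> d)" by (simp add: A.cl_join)
    then show "\<^bold>C\<^bsub>B\<^esub> (a \<^bold>\<or>\<^bsub>B\<^esub> b) = \<^bold>C\<^bsub>B\<^esub> a \<^bold>\<or>\<^bsub>B\<^esub> \<^bold>C\<^bsub>B\<^esub> b"
      using cd h by (simp add: ci A.join_closed A.cl_closed)
  next
    show "\<^bold>C\<^bsub>B\<^esub> \<^bold>0\<^bsub>B\<^esub> = \<^bold>0\<^bsub>B\<^esub>"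
      using ci(1)[OF A.zero_closed] h by (simp add: A.cl_zero)
  next
    fix b assume "b \<in> carrier B"
    then obtain a where a: "a \<in> carrier A" "b = f a" using surj by blast
    show "b \<^bold>\<le>\<^bsub>B\<^esub> \<^bold>C\<^bsub>B\<^esub> b" "\<^bold>C\<^bsub>B\<^esub> (\<^bold>C\<^bsub>B\<^esub> b) = \<^bold>C\<^bsub>B\<^esub> b"
      using le[OF A.cl_increasing a(1)] a A.cl_closed ci(1) A.cl_idem by metis+
  qed
qed

lemma bracket_alg_tca:
  assumes "tangled_closure_algebra A" "ultrafilter A x"
  shows "tangled_closure_algebra (bracket_alg A x)"
  using tca_hom_image[OF assms(1) tangled_closure_algebra.boolean_alg_bracket_alg[OF assms]
      tangled_closure_algebra.bracket_hom[OF assms]]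
  by (simp add: bracket_alg_def)

section \<open>Tangled closure in complete algebras\<close>

text \<open>Each \<open>P j\<close> reaches one of \<open>Q\<close> and its complement in one step
  along the chain and the other in two; idempotence of C merges the two steps. This makes the join
  of the chain a post-fixed point for both.\<close>

lemma complete_tangle_ge:
  fixes P :: "nat \<Rightarrow> 'b" and B (structure)
  assumes "tangled_closure_algebra B" "complete_lattice (ba_order B)"
    and P: "\<And>n. P n \<in> carrier B" and Q: "Q \<in> carrier B"
    and even: "\<And>n. P (2 * n) \<^bold>\<le> \<^bold>C (P (2 * n + 1) \<^bold>\<and> Q)"
    and odd: "\<And>n. P (2 * n + 1) \<^bold>\<le> \<^bold>C (P (2 * n + 2) \<^bold>\<and> \<^bold>- Q)"
  shows "P n \<^bold>\<le> \<^bold>C\<^sup>t {Q, \<^bold>- Q}"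
proof -
  interpret B: tangled_closure_algebra B by fact
  interpret L: complete_lattice "ba_order B" by fact
  \<comment> \<open>Completeness enters here: the infinite join exists in \<open>B\<close>.\<close>
  define b where "b = \<Squnion>\<^bsub>ba_order B\<^esub> (range P)"
  have range: "range P \<subseteq> carrier (ba_order B)" using P by auto
  have b: "b \<in> carrier B" unfolding b_def using L.sup_closed[OF range] by simp
  have upper: "P k \<^bold>\<and> b = P k" for k
    unfolding b_def using L.sup_upper[OF range, of "P k"] by simp
  have least: "b \<^bold>\<and> c = b" if "c \<in> carrier B" "\<And>k. P k \<^bold>\<and> c = P k" for c
    unfolding b_def using L.sup_least[OF range, of c] that by auto
  have Q': "\<^bold>- Q \<in> carrier B" using Q by (rule B.compl_closed)
  \<comment> \<open>One step: P k lies below \<open>b\<close>, and C is monotone.\<close>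
  have step: "P j \<^bold>\<and> \<^bold>C (X \<^bold>\<and> b) = P j"
    if "P j \<^bold>\<le> \<^bold>C (P k \<^bold>\<and> X)" "X \<in> carrier B" for j k X
  proof -
    have "(P k \<^bold>\<and> X) \<^bold>\<and> (b \<^bold>\<and> X) = P k \<^bold>\<and> X"
      using P b that(2) upper B.meet_idem by (simp add: B.meet_mono)
    then have "\<^bold>C (P k \<^bold>\<and> X) \<^bold>\<and> \<^bold>C (X \<^bold>\<and> b) = \<^bold>C (P k \<^bold>\<and> X)"
      using P b that(2) B.meet_comm[of b X]
        B.cl_mono[of "P k \<^bold>\<and> X" "X \<^bold>\<and> b"] by (simp add: B.meet_closed)
    then show ?thesis
      using that P b
        by - (rule B.meet_le_trans[of "P j" "\<^bold>C (P k \<^bold>\<and> X)"]; auto intro!: B.cl_closed B.meet_closed)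
  qed
  \<comment> \<open>Two steps: P j \<le> C(P k) \<le> C(C(X \<and> b)) = C(X \<and> b).\<close>
  have skip: "P j \<^bold>\<and> \<^bold>C (X \<^bold>\<and> b) = P j"
    if "P j \<^bold>\<le> \<^bold>C (P k \<^bold>\<and> Y)" "P k \<^bold>\<and> \<^bold>C (X \<^bold>\<and> b) = P k" "X \<in> carrier B" "Y \<in> carrier B" for j k X Y
  proof -
    have car: "P k \<in> carrier B" "P k \<^bold>\<and> Y \<in> carrier B" "\<^bold>C (X \<^bold>\<and> b) \<in> carrier B"
      using that P b by (auto intro!: B.cl_closed B.meet_closed)
    have "(P k \<^bold>\<and> Y) \<^bold>\<and> \<^bold>C (X \<^bold>\<and> b) = P k \<^bold>\<and> Y"
      using B.meet_le_trans[OF car(2,1,3)] B.meet_lower that P by blast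
    then have "\<^bold>C (P k \<^bold>\<and> Y) \<^bold>\<and> \<^bold>C (X \<^bold>\<and> b) = \<^bold>C (P k \<^bold>\<and> Y)"
      using B.cl_mono[OF car(2,3)] B.cl_idem[OF B.meet_closed[OF that(3) b]] by simp
    then show ?thesis
      using that(1) P car
        by - (rule B.meet_le_trans[of "P j" "\<^bold>C (P k \<^bold>\<and> Y)"]; auto intro!: B.cl_closed B.meet_closed)
  qed
  \<comment> \<open>The index is rewritten as twice a successor so that \<open>even\<close> can be
    applied at the next point of the chain.\<close>
  have odd': "P (2 * k + 1) \<^bold>\<le> \<^bold>C (P (2 * (k + 1)) \<^bold>\<and> \<^bold>- Q)" for k
    using odd[of k] by simp
  have "P k \<^bold>\<and> \<^bold>C (Q \<^bold>\<and> b) = P k \<and> P k \<^bold>\<and> \<^bold>C (\<^bold>- Q \<^bold>\<and> b) = P k" for k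
  proof (cases "even k")
    case True
    then obtain i where i: "k = 2 * i" by (rule evenE)
    show ?thesis unfolding i using step[OF even Q] skip[OF even step[OF odd' Q'] Q' Q] by blast
  next
    case False
    then obtain i where i: "k = 2 * i + 1" by (rule oddE)
    show ?thesis unfolding i using step[OF odd' Q'] skip[OF odd' step[OF even Q] Q Q'] by blast
  qed
  then have post: "b \<^bold>\<and> \<^bold>C (Q \<^bold>\<and> b) = b" "b \<^bold>\<and> \<^bold>C (\<^bold>- Q \<^bold>\<and> b) = b"
    using b Q Q' by (auto intro!: least B.cl_closed B.meet_closed)
  have fin: "fin_subset B {Q, \<^bold>- Q}" using Q Q' by (simp add: fin_subset_def)
  let ?T = "(\<lambda>\<gamma>. \<^bold>C (\<gamma> \<^bold>\<and> b)) ` {Q, \<^bold>- Q}"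
  have T: "finite ?T" "?T \<noteq> {}" "?T \<subseteq> carrier B"
    using b Q Q' by (auto intro!: B.cl_closed B.meet_closed)
  have "b \<^bold>\<and> \<^bold>\<And> ?T = b" using B.le_finite_Meet_iff[OF T b] post by simp
  \<comment> \<open>The implication in Ind is the unit, and so is its interior, so Ind reduces to
    \<open>b\<close> lying below the tangle.\<close>
  then have "b \<^bold>\<Rightarrow> \<^bold>\<And> ?T = \<^bold>1"
    using b B.finite_Meet_glb(1)[OF T]
    by (subst B.eq_iff_ultrafilters)
      (auto simp: B.ultrafilter_simps B.ultrafilter_one_zero intro: B.ultrafilter_mono)
  then have "b \<^bold>\<and> \<^bold>C\<^sup>t {Q, \<^bold>- Q} = b"
    using B.Ind[OF fin b] b B.meet_comm[OF B.one_closed b] by (simp add: B.itr_one B.meet_one)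
  then show ?thesis
    using B.meet_le_trans[OF P b B.tangle_closed[OF fin] upper] by simp
qed

section \<open>Existence of the base ultrafilter\<close>

text \<open>The tangle is a greatest fixed point, written as the union of all sets S from each of
  whose points every \<gamma> \<inter> S can be reached.\<close>

definition frame_alg :: "('s \<Rightarrow> 's \<Rightarrow> bool) \<Rightarrow> 's set tangle_alg" where
  "frame_alg R =
     \<lparr>carrier = UNIV, bmeet = (\<inter>), bjoin = (\<union>), bcompl = uminus, bzero = {}, bone = UNIV,
      tangle = (\<lambda>\<Gamma>. \<Union>{S. \<forall>\<gamma>\<in>\<Gamma>. \<forall>x\<in>S. \<exists>y. R x y \<and> y \<in> \<gamma> \<inter> S})\<rparr>"

lemma frame_alg_ops [simp]:
  "carrier (frame_alg R) = UNIV" "bmeet (frame_alg R) = (\<inter>)" "bjoin (frame_alg R) = (\<union>)"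
  "bcompl (frame_alg R) = uminus" "bzero (frame_alg R) = {}" "bone (frame_alg R) = UNIV"
  "tangle (frame_alg R) \<Gamma> = \<Union>{S. \<forall>\<gamma>\<in>\<Gamma>. \<forall>x\<in>S. \<exists>y. R x y \<and> y \<in> \<gamma> \<inter> S}"
  by (simp_all add: frame_alg_def)

text \<open>The set of points that see \<open>X\<close> is itself post-fixed: a witness in
  \<open>X\<close> sees itself by reflexivity and so belongs to that set.\<close>

lemma frame_alg_cl:
  assumes "reflp R"
  shows "\<^bold>C\<^bsub>frame_alg R\<^esub> X = {x. \<exists>y\<in>X. R x y}"
proof -
  have "\<forall>x\<in>{x. \<exists>y\<in>X. R x y}. \<exists>y. R x y \<and> y \<in> X \<inter> {x. \<exists>y\<in>X. R x y}"
    using assms by (auto dest: reflpD)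
  then have "{x. \<exists>y\<in>X. R x y} \<subseteq> \<^bold>C\<^bsub>frame_alg R\<^esub> X"
    unfolding cl_def frame_alg_ops by blast
  moreover have "\<^bold>C\<^bsub>frame_alg R\<^esub> X \<subseteq> {x. \<exists>y\<in>X. R x y}"
    unfolding cl_def frame_alg_ops by blast
  ultimately show ?thesis by blast
qed

lemma frame_alg_itr: "reflp R \<Longrightarrow> \<^bold>I\<^bsub>frame_alg R\<^esub> X = {x. \<forall>y. R x y \<longrightarrow> y \<in> X}"
  using frame_alg_cl[of R "- X"] by (auto simp: itr_def cl_def)

lemma frame_alg_tca:
  assumes R: "reflp R" "transp R"
  shows "tangled_closure_algebra (frame_alg R)"
proof -
  interpret boolean_alg "frame_alg R" by unfold_locales auto
  have Meet: "\<^bold>\<And>\<^bsub>frame_alg R\<^esub> T = \<Inter>T" for T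
    by (intro Meet_eqI) (auto simp: is_glb_iff)
  show ?thesis
  proof
    fix \<Gamma> a assume "fin_subset (frame_alg R) \<Gamma>"
    show "\<^bold>C\<^sup>t\<^bsub>frame_alg R\<^esub> \<Gamma> \<^bold>\<le>\<^bsub>frame_alg R\<^esub>
        \<^bold>\<And>\<^bsub>frame_alg R\<^esub> ((\<lambda>\<gamma>. \<^bold>C\<^bsub>frame_alg R\<^esub> (\<gamma> \<^bold>\<and>\<^bsub>frame_alg R\<^esub> \<^bold>C\<^sup>t\<^bsub>frame_alg R\<^esub> \<Gamma>)) ` \<Gamma>)"
      unfolding Meet frame_alg_cl[OF R(1)] ba_order_simps frame_alg_ops
      by (simp add: inf.absorb_iff1[symmetric]) blast
    let ?J = "\<^bold>I\<^bsub>frame_alg R\<^esub> (a \<^bold>\<Rightarrow>\<^bsub>frame_alg R\<^esub>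
        \<^bold>\<And>\<^bsub>frame_alg R\<^esub> ((\<lambda>\<gamma>. \<^bold>C\<^bsub>frame_alg R\<^esub> (\<gamma> \<^bold>\<and>\<^bsub>frame_alg R\<^esub> a)) ` \<Gamma>))"
    \<comment> \<open>The set ?J \<inter> a is shown post-fixed. Reflexivity applies the implication
      at \<open>x\<close> itself, giving y in \<gamma> \<inter> a, and transitivity keeps this y in
      ?J.\<close>
    have "\<exists>y. R x y \<and> y \<in> \<gamma> \<inter> (?J \<inter> a)" if \<gamma>: "\<gamma> \<in> \<Gamma>" and xJ: "x \<in> ?J \<inter> a" for \<gamma> x
    proof -
      have x: "\<forall>y. R x y \<longrightarrow> y \<in> a \<longrightarrow> (\<forall>\<gamma>\<in>\<Gamma>. \<exists>z. z \<in> \<gamma> \<and> z \<in> a \<and> R y z)" "x \<in> a"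
        using xJ by (auto simp: frame_alg_itr[OF R(1)] Meet frame_alg_cl[OF R(1)])
      then obtain y where y: "R x y" "y \<in> \<gamma>" "y \<in> a"
        using \<gamma> reflpD[OF R(1), of x] by blast
      then have "y \<in> ?J"
        using xJ transpD[OF R(2) y(1)] unfolding frame_alg_itr[OF R(1)] by blast
      then show ?thesis using y by blast
    qed
    then have "?J \<inter> a \<subseteq> \<^bold>C\<^sup>t\<^bsub>frame_alg R\<^esub> \<Gamma>"
      unfolding frame_alg_ops by blast
    then show "?J \<^bold>\<and>\<^bsub>frame_alg R\<^esub> a \<^bold>\<le>\<^bsub>frame_alg R\<^esub> \<^bold>C\<^sup>t\<^bsub>frame_alg R\<^esub> \<Gamma>"
      unfolding ba_order_simps frame_alg_ops(2) by blast
  next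
    fix a :: "'a set"
    show "\<^bold>C\<^bsub>frame_alg R\<^esub> (\<^bold>C\<^bsub>frame_alg R\<^esub> a) = \<^bold>C\<^bsub>frame_alg R\<^esub> a"
      using R by (auto simp: frame_alg_cl dest: transpD reflpD)
    show "a \<^bold>\<le>\<^bsub>frame_alg R\<^esub> \<^bold>C\<^bsub>frame_alg R\<^esub> a"
      using R by (auto simp: frame_alg_cl dest: reflpD)
  qed (auto simp: frame_alg_cl[OF R(1)])
qed

text \<open>Points see only smaller or equal points. The least element of a non-empty post-fixed set
  sees nothing in it but itself, so it would have to lie in both \<open>X\<close> and
  \<open>Y\<close>.\<close>

lemma frame_alg_tangle_disjoint:
  fixes X Y :: "'s::wellorder set"
  assumes "X \<inter> Y = {}"
  shows "\<^bold>C\<^sup>t\<^bsub>frame_alg (\<ge>)\<^esub> {X, Y} = {}"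
proof (rule ccontr)
  assume "\<^bold>C\<^sup>t\<^bsub>frame_alg (\<ge>)\<^esub> {X, Y} \<noteq> {}"
  then obtain x S where S: "x \<in> S" and post: "\<forall>\<gamma>\<in>{X, Y}. \<forall>x\<in>S. \<exists>y. x \<ge> y \<and> y \<in> \<gamma> \<inter> S"
    unfolding frame_alg_ops by blast
  define m where "m = (LEAST x. x \<in> S)"
  have "m \<in> S" unfolding m_def using S by (rule LeastI)
  moreover have "y = m" if "y \<le> m" "y \<in> S" for y
    using that Least_le[of "\<lambda>x. x \<in> S" y] unfolding m_def by (simp add: antisym)
  ultimately have "m \<in> X" "m \<in> Y" using post by blast+
  then show False using assms by blast
qed

section \<open>Compactness over ever longer finite chains\<close>

lemma base_ultrafilter_exists:
  assumes free: "countably_free_tca A (range p \<union> {q})" and "inj p" "q \<notin> range p"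
  shows "\<exists>x. base_ultrafilter A p q x"
proof -
  interpret A: tangled_closure_algebra A
    using free by (simp add: countably_free_tca_def)
  note A = A.tangled_closure_algebra_axioms
  have car: "p k \<in> carrier A" "q \<in> carrier A" for k
    using free by (auto simp: countably_free_tca_def tca_generated_by_def)
  let ?B = "frame_alg ((\<ge>) :: nat \<Rightarrow> nat \<Rightarrow> bool)"
  have refl: "reflp ((\<ge>) :: nat \<Rightarrow> nat \<Rightarrow> bool)" by (simp add: reflp_def)
  have B: "tangled_closure_algebra ?B"
    by (intro frame_alg_tca refl) (auto simp: transp_def)
  have "\<exists>h. tca_hom A ?B h \<and> (\<forall>k. h (p k) = (if k \<le> 2 * M then {2 * M - k} else {}))
      \<and> h q = Collect odd" for M :: nat
  proof -
    \<comment> \<open>\<open>inv p\<close> recovers the index of a generator since \<open>p\<close>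
      is injective. Generators beyond the end of the chain get the empty set.\<close>
    let ?g = "\<lambda>v. if v = q then Collect odd
      else if inv p v \<le> 2 * M then {2 * M - inv p v} else {}"
    have "unique_extension A (range p \<union> {q}) ?B ?g"
      by (intro countably_free_tca_universal[OF free B]) simp
    then obtain h where h: "tca_hom A ?B h" "\<forall>v\<in>range p \<union> {q}. h v = ?g v"
      unfolding unique_extension_def by blast
    have "p k \<noteq> q" for k using assms(3) by blast
    then have "h (p k) = (if k \<le> 2 * M then {2 * M - k} else {})" for k
      using h(2) \<open>inj p\<close> by (simp add: inv_f_f)
    then show ?thesis using h by (intro exI[of _ h]) simp
  qed
  then obtain h where h: "\<And>M. tca_hom A ?B (h M)"
    and hp: "\<And>M k. h M (p k) = (if k \<le> 2 * M then {2 * M - k} else {})"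
    and hq: "\<And>M. h M q = Collect odd"
    by metis
  note hom = h[unfolded tca_hom_def ba_hom_def, simplified]
  have hcl: "h M (\<^bold>C\<^bsub>A\<^esub> a) = {x. \<exists>y\<in>h M a. y \<le> x}" and hitr: "h M (\<^bold>I\<^bsub>A\<^esub> a) = {x. \<forall>y\<le>x. y \<in> h M a}"
    if "a \<in> carrier A" for M a
    using tca_hom_cl_itr[OF A h that] frame_alg_cl[OF refl] frame_alg_itr[OF refl] by simp_all
  \<comment> \<open>The elements true at the starting point 2M of all but finitely many
    interpretations. The filter is proper because zero is always interpreted as the empty set, so it
    extends to an ultrafilter.\<close>
  let ?F = "{a \<in> carrier A. \<forall>\<^sub>F M in sequentially. 2 * M \<in> h M a}"
  have F: "ba_filter A ?F"
  proof -
    have "\<forall>\<^sub>F M in sequentially. 2 * M \<in> h M b"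
      if "\<forall>\<^sub>F M in sequentially. 2 * M \<in> h M a" "a \<in> carrier A" "b \<in> carrier A" "a \<^bold>\<and>\<^bsub>A\<^esub> b = a" for a b
    proof -
      have "h M a \<subseteq> h M b" for M using that hom[of M] by (metis inf.absorb_iff1)
      then show ?thesis using that(1) by (auto elim!: eventually_mono)
    qed
    moreover have "\<forall>\<^sub>F M in sequentially. 2 * M \<in> h M (a \<^bold>\<and>\<^bsub>A\<^esub> b)"
      if "\<forall>\<^sub>F M in sequentially. 2 * M \<in> h M a" "\<forall>\<^sub>F M in sequentially. 2 * M \<in> h M b"
        "a \<in> carrier A" "b \<in> carrier A" for a b
      using that(1,2) by eventually_elim (use that hom in simp)
    ultimately show ?thesis
      using hom by (auto simp: ba_filter_def A.one_closed A.meet_closed)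
  qed
  have "\<^bold>0\<^bsub>A\<^esub> \<notin> ?F" using hom by simp
  then obtain x where x: "ultrafilter A x" "?F \<subseteq> x"
    using A.ultrafilter_separation[OF F A.zero_closed] by blast
  have fin: "fin_subset A {q, \<^bold>-\<^bsub>A\<^esub> q}" using car A.compl_closed by (simp add: fin_subset_def)
  have "h M (\<^bold>C\<^sup>t\<^bsub>A\<^esub> {q, \<^bold>-\<^bsub>A\<^esub> q}) = {}" for M
  proof -
    have "h M (\<^bold>C\<^sup>t\<^bsub>A\<^esub> {q, \<^bold>-\<^bsub>A\<^esub> q}) = \<^bold>C\<^sup>t\<^bsub>?B\<^esub> {h M q, - h M q}"
      using h[of M] fin car by (simp add: tca_hom_def ba_hom_def)
    then show ?thesis using frame_alg_tangle_disjoint[of "h M q" "- h M q"] by simp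
  qed
  then have "\<^bold>-\<^bsub>A\<^esub> \<^bold>C\<^sup>t\<^bsub>A\<^esub> {q, \<^bold>-\<^bsub>A\<^esub> q} \<in> ?F"
    using hom A.tangle_closed[OF fin] by (simp add: A.compl_closed)
  then have "\<^bold>C\<^sup>t\<^bsub>A\<^esub> {q, \<^bold>-\<^bsub>A\<^esub> q} \<notin> x"
    using x A.ultrafilter_compl[OF x(1) A.tangle_closed[OF fin]] by blast
  moreover have "p 0 \<in> x" using x(2) car hp by auto
  \<comment> \<open>Both families of requirements at once, with \<open>r\<close> either
    \<open>q\<close> or its complement. The condition k < 2M keeps the natural subtraction from
    truncating, so that the parity of 2M - (k + 1) is opposite to that of \<open>k\<close>.\<close>
  moreover have "\<^bold>I\<^bsub>A\<^esub> (p k \<^bold>\<Rightarrow>\<^bsub>A\<^esub> \<^bold>C\<^bsub>A\<^esub> (p (k + 1) \<^bold>\<and>\<^bsub>A\<^esub> r)) \<in> x"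
    if r: "r \<in> carrier A" "\<And>M. k < 2 * M \<Longrightarrow> 2 * M - (k + 1) \<in> h M r" for k r
  proof -
    note cl = A.cl_closed[OF A.meet_closed[OF car(1) r(1)]]
    note im = A.join_closed[OF A.compl_closed[OF car(1)] cl]
    \<comment> \<open>For k < M the generator p (k + 1) is interpreted by the point just below that
      of \<open>p k\<close>, which sees it. The implication then holds at every point, hence so does
      its interior.\<close>
    have "h M (\<^bold>I\<^bsub>A\<^esub> (p k \<^bold>\<Rightarrow>\<^bsub>A\<^esub> \<^bold>C\<^bsub>A\<^esub> (p (k + 1) \<^bold>\<and>\<^bsub>A\<^esub> r))) = UNIV" if "k < M" for M
    proof -
      have "h M (\<^bold>C\<^bsub>A\<^esub> (p (k + 1) \<^bold>\<and>\<^bsub>A\<^esub> r)) = {x. 2 * M - (k + 1) \<le> x}"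
        using hcl[OF A.meet_closed[OF car(1) r(1)]] hom[of M] hp[of M "k + 1"] r car that by auto
      then have "h M (p k \<^bold>\<Rightarrow>\<^bsub>A\<^esub> \<^bold>C\<^bsub>A\<^esub> (p (k + 1) \<^bold>\<and>\<^bsub>A\<^esub> r)) = UNIV"
        using hom[of M] hp[of M k] car cl A.compl_closed that by auto
      then show ?thesis using hitr[OF im] by simp
    qed
    then have "\<forall>\<^sub>F M in sequentially. 2 * M \<in> h M (\<^bold>I\<^bsub>A\<^esub> (p k \<^bold>\<Rightarrow>\<^bsub>A\<^esub> \<^bold>C\<^bsub>A\<^esub> (p (k + 1) \<^bold>\<and>\<^bsub>A\<^esub> r)))"
      by (intro eventually_sequentiallyI[of "Suc k"]) simp
    then show ?thesis using x(2) A.itr_closed[OF im] by blast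
  qed
  note chain = this
  have "\<^bold>I\<^bsub>A\<^esub> (p (2 * n) \<^bold>\<Rightarrow>\<^bsub>A\<^esub> \<^bold>C\<^bsub>A\<^esub> (p (2 * n + 1) \<^bold>\<and>\<^bsub>A\<^esub> q)) \<in> x" for n
    by (rule chain) (auto simp: car hq)
  moreover have "\<^bold>I\<^bsub>A\<^esub> (p (2 * n + 1) \<^bold>\<Rightarrow>\<^bsub>A\<^esub> \<^bold>C\<^bsub>A\<^esub> (p (2 * n + 2) \<^bold>\<and>\<^bsub>A\<^esub> \<^bold>-\<^bsub>A\<^esub> q)) \<in> x" for n
    using chain[of "\<^bold>-\<^bsub>A\<^esub> q" "2 * n + 1"] hom by (simp add: car hq A.compl_closed)
  ultimately show ?thesis
    using x(1) by (intro exI[of _ x]) (auto simp: base_ultrafilter_def)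
qed

section \<open>No embedding into a complete algebra\<close>

lemma no_embedding_into_complete:
  assumes A: "tangled_closure_algebra A" and car: "\<And>n. p n \<in> carrier A" "q \<in> carrier A"
    and base: "base_ultrafilter A p q x"
    and B: "tangled_closure_algebra B" "complete_lattice (ba_order B)"
    and f: "tca_hom (bracket_alg A x) B f" "inj_on f (carrier (bracket_alg A x))"
  shows False
proof -
  interpret A: tangled_closure_algebra A by fact
  have x: "ultrafilter A x" using base by (simp add: base_ultrafilter_def)
  \<comment> \<open>Composing with the bracket map turns statements about the algebra of sets into
    statements about elements of \<open>A\<close>.\<close>
  define h where "h = f \<circ> bracket A x"
  have h: "tca_hom A B h"
    unfolding h_def by (rule tca_hom_compose[OF A.bracket_hom[OF x] f(1)])
  note hom = h[unfolded tca_hom_def ba_hom_def]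
  \<comment> \<open>The order is an equation between meets, so injectivity of \<open>f\<close> makes
    it reflect inclusions as well as preserve them.\<close>
  have inj: "bracket A x a \<subseteq> bracket A x b \<longleftrightarrow> h a \<^bold>\<le>\<^bsub>B\<^esub> h b" if "a \<in> carrier A" "b \<in> carrier A" for a b
  proof -
    have "h a \<^bold>\<le>\<^bsub>B\<^esub> h b \<longleftrightarrow> h (a \<^bold>\<and>\<^bsub>A\<^esub> b) = h a" using hom that by simp
    also have "\<dots> \<longleftrightarrow> bracket A x (a \<^bold>\<and>\<^bsub>A\<^esub> b) = bracket A x a"
      using inj_on_eq_iff[OF f(2)] that by (simp add: h_def bracket_alg_def A.meet_closed)
    finally show ?thesis using A.bracket_meet[OF that] by blast
  qed
  \<comment> \<open>A requirement in \<open>x\<close> is an inclusion of brackets by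
    \<open>bracket_subset_iff\<close>, hence an inequality in \<open>B\<close>.\<close>
  have step: "h a \<^bold>\<le>\<^bsub>B\<^esub> \<^bold>C\<^bsub>B\<^esub> (h b \<^bold>\<and>\<^bsub>B\<^esub> h c)"
    if "\<^bold>I\<^bsub>A\<^esub> (a \<^bold>\<Rightarrow>\<^bsub>A\<^esub> \<^bold>C\<^bsub>A\<^esub> (b \<^bold>\<and>\<^bsub>A\<^esub> c)) \<in> x" "a \<in> carrier A" "b \<in> carrier A" "c \<in> carrier A" for a b c
  proof -
    note m = A.meet_closed[OF that(3,4)]
    have "h a \<^bold>\<le>\<^bsub>B\<^esub> h (\<^bold>C\<^bsub>A\<^esub> (b \<^bold>\<and>\<^bsub>A\<^esub> c))"
      using that(1) A.bracket_subset_iff[OF x that(2) A.cl_closed[OF m]]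
        inj[OF that(2) A.cl_closed[OF m]] by blast
    then show ?thesis using tca_hom_cl_itr(1)[OF A h m] hom that by simp
  qed
  note q' = A.compl_closed[OF car(2)]
  have hq': "h (\<^bold>-\<^bsub>A\<^esub> q) = \<^bold>-\<^bsub>B\<^esub> h q" using hom car by blast
  have fin: "fin_subset A {q, \<^bold>-\<^bsub>A\<^esub> q}" using car q' by (simp add: fin_subset_def)
  have "h (p 0) \<^bold>\<le>\<^bsub>B\<^esub> \<^bold>C\<^sup>t\<^bsub>B\<^esub> {h q, \<^bold>-\<^bsub>B\<^esub> h q}"
  proof (rule complete_tangle_ge[OF B, where P = "\<lambda>n. h (p n)"])
    show "h (p n) \<in> carrier B" "h q \<in> carrier B" for n using hom car by auto
    show "h (p (2 * n)) \<^bold>\<le>\<^bsub>B\<^esub> \<^bold>C\<^bsub>B\<^esub> (h (p (2 * n + 1)) \<^bold>\<and>\<^bsub>B\<^esub> h q)" for n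
      using base car by (intro step) (auto simp: base_ultrafilter_def)
    show "h (p (2 * n + 1)) \<^bold>\<le>\<^bsub>B\<^esub> \<^bold>C\<^bsub>B\<^esub> (h (p (2 * n + 2)) \<^bold>\<and>\<^bsub>B\<^esub> \<^bold>-\<^bsub>B\<^esub> h q)" for n
      unfolding hq'[symmetric] using base car q'
      by (intro step) (auto simp: base_ultrafilter_def)
  qed
  moreover have "h (\<^bold>C\<^sup>t\<^bsub>A\<^esub> {q, \<^bold>-\<^bsub>A\<^esub> q}) = \<^bold>C\<^sup>t\<^bsub>B\<^esub> {h q, \<^bold>-\<^bsub>B\<^esub> h q}"
    using hom fin hq' by simp
  ultimately have "bracket A x (p 0) \<subseteq> bracket A x (\<^bold>C\<^sup>t\<^bsub>A\<^esub> {q, \<^bold>-\<^bsub>A\<^esub> q})"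
    using inj[OF car(1) A.tangle_closed[OF fin]] by simp
  \<comment> \<open>The point \<open>x\<close> of U contains \<open>p 0\<close> but not the
    tangle.\<close>
  then show False
    using base A.self_successor[OF x] by (auto simp: bracket_def base_ultrafilter_def)
qed

text \<open>Existence of the ultrafilter and well-definedness of the algebra of sets are part of the
  conclusion, so the non-embedding claim is not vacuous.\<close>

theorem theorem5p3:
  fixes A\<^sub>0 :: "'a tangle_alg" and p :: "nat \<Rightarrow> 'a" and q :: 'a
  assumes "countably_free_tca A\<^sub>0 (range p \<union> {q})"
    and "inj p" and "q \<notin> range p"
  shows "(\<exists>x\<^sub>0. base_ultrafilter A\<^sub>0 p q x\<^sub>0) \<and>
    (\<forall>x\<^sub>0. base_ultrafilter A\<^sub>0 p q x\<^sub>0 \<longrightarrow>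
      (\<forall>\<Gamma>. fin_subset A\<^sub>0 \<Gamma> \<longrightarrow>
        \<^bold>C\<^sup>t\<^bsub>bracket_alg A\<^sub>0 x\<^sub>0\<^esub> (bracket A\<^sub>0 x\<^sub>0 ` \<Gamma>) = bracket A\<^sub>0 x\<^sub>0 (\<^bold>C\<^sup>t\<^bsub>A\<^sub>0\<^esub> \<Gamma>)) \<and>
      tangled_closure_algebra (bracket_alg A\<^sub>0 x\<^sub>0) \<and>
      (\<forall>B :: 'b tangle_alg. tangled_closure_algebra B \<and> complete_lattice (ba_order B) \<longrightarrow>
        \<not> (\<exists>f. tca_hom (bracket_alg A\<^sub>0 x\<^sub>0) B f \<and> inj_on f (carrier (bracket_alg A\<^sub>0 x\<^sub>0)))))"
proof (intro conjI allI impI)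
  have A: "tangled_closure_algebra A\<^sub>0" and car: "\<And>n. p n \<in> carrier A\<^sub>0" "q \<in> carrier A\<^sub>0"
    using assms(1) by (auto simp: countably_free_tca_def tca_generated_by_def)
  show "\<exists>x\<^sub>0. base_ultrafilter A\<^sub>0 p q x\<^sub>0"
    using assms by (rule base_ultrafilter_exists)
  fix x\<^sub>0 assume base: "base_ultrafilter A\<^sub>0 p q x\<^sub>0"
  then have x: "ultrafilter A\<^sub>0 x\<^sub>0" by (simp add: base_ultrafilter_def)
  show "tangled_closure_algebra (bracket_alg A\<^sub>0 x\<^sub>0)"
    using A x by (rule bracket_alg_tca)
  show "\<^bold>C\<^sup>t\<^bsub>bracket_alg A\<^sub>0 x\<^sub>0\<^esub> (bracket A\<^sub>0 x\<^sub>0 ` \<Gamma>) = bracket A\<^sub>0 x\<^sub>0 (\<^bold>C\<^sup>t\<^bsub>A\<^sub>0\<^esub> \<Gamma>)"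
    if "fin_subset A\<^sub>0 \<Gamma>" for \<Gamma>
    using A x that by (rule tangled_closure_algebra.bracket_alg_tangle)
  show "\<not> (\<exists>f. tca_hom (bracket_alg A\<^sub>0 x\<^sub>0) B f \<and> inj_on f (carrier (bracket_alg A\<^sub>0 x\<^sub>0)))"
    if "tangled_closure_algebra B \<and> complete_lattice (ba_order B)" for B :: "'b tangle_alg"
    using no_embedding_into_complete[OF A car base] that by blast
qed

end
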